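(* Let $K$ be a field, let $A$ be an s-unital $K$-algebra, and let $R=A\otimes_K L_K(1,\infty)$. Assume that every nonzero right ideal in every quotient of $A$ contains a nonzero idempotent. Then $R$ is properly purely infinite.
   Context: Rings and algebras are associative and not necessarily unital unless stated. A ring $R$ is s-unital if for each $x\in R$ there exist $u,v\in R$ with $ux=xv=x$. The Leavitt algebra $L_K(1,\infty)$ is the unital $K$-algebra with generators $x_1,y_1,x_2,y_2,\dots$ and relations $x_iy_j=\delta_{ij}$ for all $i,j$. For a ring $R$, an element $a\in R$ is properly infinite if $a\neq 0$ and there exist $\alpha_1,\alpha_2,\beta_1,\beta_2\in R$ with $\alpha_i a\beta_j=\delta_{ij}a$ for all $i,j\in\{1,2\}$. A ring is properly purely infinite if every nonzero element of it is properly infinite. *)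

theory Defs
  imports "HOL-Algebra.QuotRing" "HOL-Algebra.Module"
begin

section \<open>Rings and algebras without unit\<close>

text \<open>
  Rings that need not have a unit are represented by the records of HOL-Algebra. The field
  \<open>one\<close> of such a record carries no information: no axiom below mentions it.
\<close>

locale nonunital_ring = abelian_group R for R (structure) +
  assumes mult_closed:
      "\<lbrakk>x \<in> carrier R; y \<in> carrier R\<rbrakk> \<Longrightarrow> x \<otimes> y \<in> carrier R"
    and mult_assoc:
      "\<lbrakk>x \<in> carrier R; y \<in> carrier R; z \<in> carrier R\<rbrakk> \<Longrightarrow> (x \<otimes> y) \<otimes> z = x \<otimes> (y \<otimes> z)"
    and mult_l_distr:
      "\<lbrakk>x \<in> carrier R; y \<in> carrier R; z \<in> carrier R\<rbrakk>
        \<Longrightarrow> (x \<oplus> y) \<otimes> z = x \<otimes> z \<oplus> y \<otimes> z"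
    and mult_r_distr:
      "\<lbrakk>x \<in> carrier R; y \<in> carrier R; z \<in> carrier R\<rbrakk>
        \<Longrightarrow> z \<otimes> (x \<oplus> y) = z \<otimes> x \<oplus> z \<otimes> y"

locale nonunital_algebra = module K A + nonunital_ring A
  for K (structure) and A (structure) +
  assumes smult_mult_left:
      "\<lbrakk>c \<in> carrier K; x \<in> carrier A; y \<in> carrier A\<rbrakk>
        \<Longrightarrow> (c \<odot>\<^bsub>A\<^esub> x) \<otimes>\<^bsub>A\<^esub> y = c \<odot>\<^bsub>A\<^esub> (x \<otimes>\<^bsub>A\<^esub> y)"
    and smult_mult_right:
      "\<lbrakk>c \<in> carrier K; x \<in> carrier A; y \<in> carrier A\<rbrakk>
        \<Longrightarrow> x \<otimes>\<^bsub>A\<^esub> (c \<odot>\<^bsub>A\<^esub> y) = c \<odot>\<^bsub>A\<^esub> (x \<otimes>\<^bsub>A\<^esub> y)"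

locale s_unital_ring = nonunital_ring R for R (structure) +
  assumes s_unital: "x \<in> carrier R \<Longrightarrow> \<exists>u\<in>carrier R. \<exists>v\<in>carrier R. u \<otimes> x = x \<and> x \<otimes> v = x"

text \<open>
  The library locale \<open>ideal\<close> presupposes a ring with unit, whence the following versions.
  The library quotient \<^term>\<open>R Quot I\<close> makes sense for rings without unit as well.
  Closure under scalars is not required: in an s-unital algebra over a field, the ideals and
  one-sided ideals of the underlying ring are automatically closed under scalar multiplication.
\<close>

locale two_sided_ideal = additive_subgroup I R for I and R (structure) +
  assumes l_absorb: "\<lbrakk>x \<in> I; r \<in> carrier R\<rbrakk> \<Longrightarrow> r \<otimes> x \<in> I"
    and r_absorb: "\<lbrakk>x \<in> I; r \<in> carrier R\<rbrakk> \<Longrightarrow> x \<otimes> r \<in> I"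

locale right_ideal = additive_subgroup J R for J and R (structure) +
  assumes absorb: "\<lbrakk>x \<in> J; r \<in> carrier R\<rbrakk> \<Longrightarrow> x \<otimes> r \<in> J"

definition is_idempotent :: "('a, 'm) ring_scheme \<Rightarrow> 'a \<Rightarrow> bool"
  where "is_idempotent R e \<longleftrightarrow> e \<in> carrier R \<and> e \<otimes>\<^bsub>R\<^esub> e = e"

definition properly_infinite :: "('a, 'm) ring_scheme \<Rightarrow> 'a \<Rightarrow> bool"
  where "properly_infinite R a \<longleftrightarrow> a \<noteq> \<zero>\<^bsub>R\<^esub> \<and>
    (\<exists>\<alpha> \<beta> :: nat \<Rightarrow> 'a.
      (\<forall>i\<in>{1,2}. \<alpha> i \<in> carrier R \<and> \<beta> i \<in> carrier R) \<and>
      (\<forall>i\<in>{1,2}. \<forall>j\<in>{1,2}. \<alpha> i \<otimes>\<^bsub>R\<^esub> a \<otimes>\<^bsub>R\<^esub> \<beta> j = (if i = j then a else \<zero>\<^bsub>R\<^esub>)))"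

locale properly_purely_infinite_ring = nonunital_ring R for R (structure) +
  assumes properly_infinite: "\<lbrakk>a \<in> carrier R; a \<noteq> \<zero>\<rbrakk> \<Longrightarrow> properly_infinite R a"


section \<open>Semigroup algebras and quotient algebras\<close>

text \<open>
  The algebra of finitely supported functions on a semigroup \<open>S\<close> with the convolution product.
  The function with value \<open>1\<close> at \<open>s\<close> and \<open>0\<close> elsewhere is the basis element \<open>s\<close>. The field
  \<open>one\<close> is meaningful only if \<open>S\<close> is a monoid.
\<close>

definition basis_elem :: "('k, 'c) ring_scheme \<Rightarrow> 's \<Rightarrow> 's \<Rightarrow> 'k"
  where "basis_elem K s = (\<lambda>t. if t = s then \<one>\<^bsub>K\<^esub> else \<zero>\<^bsub>K\<^esub>)"

definition semigroup_algebra ::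
    "('k, 'c) ring_scheme \<Rightarrow> ('s, 'n) monoid_scheme \<Rightarrow> ('k, 's \<Rightarrow> 'k) module"
  where "semigroup_algebra K S =
    \<lparr>carrier = {f. range f \<subseteq> carrier K \<and> {s. f s \<noteq> \<zero>\<^bsub>K\<^esub>} \<subseteq> carrier S \<and> finite {s. f s \<noteq> \<zero>\<^bsub>K\<^esub>}},
     mult = (\<lambda>f g s.
       \<Oplus>\<^bsub>K\<^esub>p \<in> {(u, v). f u \<noteq> \<zero>\<^bsub>K\<^esub> \<and> g v \<noteq> \<zero>\<^bsub>K\<^esub> \<and> u \<otimes>\<^bsub>S\<^esub> v = s}. f (fst p) \<otimes>\<^bsub>K\<^esub> g (snd p)),
     one = basis_elem K \<one>\<^bsub>S\<^esub>,
     zero = (\<lambda>s. \<zero>\<^bsub>K\<^esub>),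
     add = (\<lambda>f g s. f s \<oplus>\<^bsub>K\<^esub> g s),
     smult = (\<lambda>c f s. c \<otimes>\<^bsub>K\<^esub> f s)\<rparr>"

text \<open>The library quotient ring, with the induced scalar multiplication.\<close>

definition quotient_algebra :: "('k, 'a, 'm) module_scheme \<Rightarrow> 'a set \<Rightarrow> ('k, 'a set) module"
  where "quotient_algebra A I =
    ring.extend (A Quot I) (module.fields (\<lambda>c X. \<Union>x\<in>X. I +>\<^bsub>A\<^esub> (c \<odot>\<^bsub>A\<^esub> x)))"


section \<open>The Leavitt algebra \<open>L\<^sub>K(1,\<infinity>)\<close>\<close>

text \<open>The generators are indexed from \<open>0\<close>.\<close>

datatype leavitt_gen = X nat | Y nat

definition word_monoid :: "'g list monoid"
  where "word_monoid = \<lparr>carrier = UNIV, mult = (@), one = []\<rparr>"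

definition free_algebra :: "('k, 'c) ring_scheme \<Rightarrow> ('k, 'g list \<Rightarrow> 'k) module"
  where "free_algebra K = semigroup_algebra K word_monoid"

definition leavitt_relators :: "('k, 'c) ring_scheme \<Rightarrow> (leavitt_gen list \<Rightarrow> 'k) set"
  where "leavitt_relators K =
    (let F = free_algebra K in
      {basis_elem K [X i] \<otimes>\<^bsub>F\<^esub> basis_elem K [Y j] \<ominus>\<^bsub>F\<^esub> (if i = j then \<one>\<^bsub>F\<^esub> else \<zero>\<^bsub>F\<^esub>) |i j. True})"

definition leavitt_algebra ::
    "('k, 'c) ring_scheme \<Rightarrow> ('k, (leavitt_gen list \<Rightarrow> 'k) set) module"
  where "leavitt_algebra K =
    quotient_algebra (free_algebra K) (Idl\<^bsub>free_algebra K\<^esub> (leavitt_relators K))"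


section \<open>The tensor product of two algebras\<close>

text \<open>
  The free \<open>K\<close>-module on the set of pairs \<open>(a, b)\<close>, modulo the submodule generated by the
  bilinearity relations. As the pairs form a semigroup under componentwise multiplication, the
  free module is a semigroup algebra. Its product, for which the submodule is an ideal, induces
  the usual product \<open>(a \<otimes> b) (a' \<otimes> b') = a a' \<otimes> b b'\<close> on the quotient.
\<close>

definition tensor_relators ::
    "('k, 'c) ring_scheme \<Rightarrow> ('k, 'a, 'm) module_scheme \<Rightarrow> ('k, 'b, 'n) module_scheme
      \<Rightarrow> ('a \<times> 'b \<Rightarrow> 'k) set"
  where "tensor_relators K A B =
    (let F = semigroup_algebra K (A \<times>\<times> B); t = (\<lambda>a b. basis_elem K (a, b)) in
      {t (a \<oplus>\<^bsub>A\<^esub> a') b \<ominus>\<^bsub>F\<^esub> (t a b \<oplus>\<^bsub>F\<^esub> t a' b) |a a' b.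
        a \<in> carrier A \<and> a' \<in> carrier A \<and> b \<in> carrier B} \<union>
      {t a (b \<oplus>\<^bsub>B\<^esub> b') \<ominus>\<^bsub>F\<^esub> (t a b \<oplus>\<^bsub>F\<^esub> t a b') |a b b'.
        a \<in> carrier A \<and> b \<in> carrier B \<and> b' \<in> carrier B} \<union>
      {t (c \<odot>\<^bsub>A\<^esub> a) b \<ominus>\<^bsub>F\<^esub> c \<odot>\<^bsub>F\<^esub> t a b |c a b.
        c \<in> carrier K \<and> a \<in> carrier A \<and> b \<in> carrier B} \<union>
      {t a (c \<odot>\<^bsub>B\<^esub> b) \<ominus>\<^bsub>F\<^esub> c \<odot>\<^bsub>F\<^esub> t a b |c a b.
        c \<in> carrier K \<and> a \<in> carrier A \<and> b \<in> carrier B})"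

definition generated_submodule ::
    "('k, 'c) ring_scheme \<Rightarrow> ('k, 'a, 'm) module_scheme \<Rightarrow> 'a set \<Rightarrow> 'a set"
  where "generated_submodule K M S = \<Inter>{N. submodule N K M \<and> S \<subseteq> N}"

definition tensor_algebra ::
    "('k, 'c) ring_scheme \<Rightarrow> ('k, 'a, 'm) module_scheme \<Rightarrow> ('k, 'b, 'n) module_scheme
      \<Rightarrow> ('k, ('a \<times> 'b \<Rightarrow> 'k) set) module"
  where "tensor_algebra K A B =
    (let F = semigroup_algebra K (A \<times>\<times> B) in
      quotient_algebra F (generated_submodule K F (tensor_relators K A B)))"

end

theory Submission
  imports Defs "HOL-Library.Sublist"
begin

text \<open>
  Write \<open>r \<oplus> s \<precsim> r\<close> if some rows \<open>\<rho>\<^sub>1, \<rho>\<^sub>2\<close> and columns \<open>\<kappa>\<^sub>1, \<kappa>\<^sub>2\<close> over \<open>R\<close> satisfy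
  \<open>(\<rho>\<^sub>i r \<kappa>\<^sub>j) = diag(r, s)\<close>; say that \<open>r\<close> absorbs \<open>s\<close>. A nonzero \<open>r\<close> is properly infinite iff it
  absorbs itself. The elements that a fixed \<open>r\<close> absorbs form a two-sided ideal \<open>T\<close>
  (\<open>absorbed_ideal\<close>), and an equation \<open>(\<rho>\<^sub>i r \<kappa>\<^sub>j) = diag(r, s)\<close> that holds only modulo \<open>T\<close> can be
  corrected to an exact one (\<open>compression_perturb\<close>). So in \<open>R/T\<close> the image of \<open>r\<close> absorbs nothing
  but \<open>0\<close> (\<open>absorbed_quotient\<close>), and it remains to see that an element that absorbs nothing but
  \<open>0\<close> is \<open>0\<close>: then \<open>r \<in> T\<close>.

  Replace \<open>R\<close> by \<open>R/T\<close> and suppose that \<open>r \<noteq> 0\<close> absorbs only \<open>0\<close>. The relations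
  \<open>x\<^sub>i y\<^sub>j = \<delta>\<^sub>i\<^sub>j\<close> rewrite \<open>r\<close> as a finite sum of terms \<open>a\<^sub>\<mu>\<^sub>\<nu> \<otimes> y\<^sub>\<mu> x\<^sub>\<nu>\<close>. Multiplication by suitable words
  \<open>x\<^sub>N x\<^sub>\<mu>\<close> on the left and \<open>y\<^sub>\<nu> y\<^sub>N\<close> on the right, with \<open>N\<close> a fresh index, kills all terms but one and
  leaves \<open>a \<otimes> 1 \<noteq> 0\<close> (\<open>extract_coefficient\<close>). Let \<open>J\<close> be the ideal of the \<open>c \<in> A\<close> with
  \<open>c \<otimes> 1 = 0\<close>. The nonzero right ideal of \<open>A/J\<close> generated by \<open>a\<close> contains a nonzero idempotent
  \<open>ab + J\<close>, so \<open>E = ab \<otimes> 1\<close> is a nonzero idempotent of the form \<open>\<alpha> r \<beta>\<close> (\<open>idempotent_multiple\<close>).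
  Here \<open>ab\<close> is idempotent only modulo \<open>J\<close>, but the elements of \<open>J\<close> vanish in \<open>R\<close>.

  Finally \<open>E\<close> is properly infinite, through \<open>x\<^sub>0, x\<^sub>1, y\<^sub>0, y\<^sub>1\<close>. An idempotent \<open>E = \<alpha> r \<beta>\<close> splits off
  from \<open>r\<close>, so that \<open>r \<sim> E \<oplus> r'\<close>, whence \<open>r \<oplus> E \<sim> E \<oplus> E \<oplus> r' \<precsim> E \<oplus> r' \<sim> r\<close>. Thus \<open>r\<close> absorbs
  \<open>E \<noteq> 0\<close> (\<open>idempotent_absorbed\<close>), a contradiction.

  All that this argument needs from \<open>A \<otimes> L(1,\<infinity>)\<close> is that it is spanned by elements
  \<open>a \<otimes> w\<close>, with \<open>w\<close> a word in the generators, that multiply in the expected way (locale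
  \<open>leavitt_span\<close>). These properties pass to quotients, which is what makes the reduction to
  \<open>R/T\<close> possible. The second half of the development checks that the tensor product of
  quotients of semigroup algebras is an instance.
\<close>

section \<open>Rings without unit and their quotients\<close>

context nonunital_ring
begin

lemma zero_mult [simp]: "x \<in> carrier R \<Longrightarrow> \<zero> \<otimes> x = \<zero>"
  by (metis mult_closed mult_l_distr zero_closed add.l_cancel_one' r_zero)

lemma mult_zero [simp]: "x \<in> carrier R \<Longrightarrow> x \<otimes> \<zero> = \<zero>"
  by (metis mult_closed mult_r_distr zero_closed add.l_cancel_one' r_zero)

lemma minus_mult: "x \<in> carrier R \<Longrightarrow> y \<in> carrier R \<Longrightarrow> (\<ominus> x) \<otimes> y = \<ominus> (x \<otimes> y)"
  by (metis a_inv_closed l_neg minus_equality mult_closed mult_l_distr zero_mult)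

lemma mult_minus: "x \<in> carrier R \<Longrightarrow> y \<in> carrier R \<Longrightarrow> x \<otimes> (\<ominus> y) = \<ominus> (x \<otimes> y)"
  by (metis a_inv_closed l_neg minus_equality mult_closed mult_r_distr mult_zero)

lemma minus_zero: "\<ominus> \<zero> = \<zero>"
  by (rule minus_equality) simp_all

lemmas nonunital_simprules =
  a_closed zero_closed a_inv_closed minus_closed mult_closed
  a_assoc l_zero l_neg a_comm mult_assoc mult_l_distr minus_eq
  r_zero r_neg r_neg2 r_neg1 minus_add minus_minus minus_zero
  a_lcomm mult_r_distr zero_mult mult_zero minus_mult mult_minus

end

locale nonunital_ideal = nonunital_ring R + two_sided_ideal I R for I and R (structure)
begin

sublocale abelian_subgroup I R
  using abelian_subgroupI3 additive_subgroup_axioms abelian_group_axioms by blast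

lemma coset_eq_iff:
  assumes "x \<in> carrier R" "y \<in> carrier R"
  shows "I +> x = I +> y \<longleftrightarrow> x \<ominus> y \<in> I"
proof
  assume "I +> x = I +> y"
  then show "x \<ominus> y \<in> I"
    by (metis a_coset_add_inv2 a_coset_join1 a_subgroup a_subset assms minus_closed minus_eq)
next
  assume "x \<ominus> y \<in> I"
  then show "I +> x = I +> y"
    by (metis a_coset_add_inv1 a_coset_join2 a_subgroup a_subset assms minus_closed minus_eq)
qed

lemma coset_eq_zero_iff: "x \<in> carrier R \<Longrightarrow> I +> x = I \<longleftrightarrow> x \<in> I"
  using a_coset_join1 a_coset_join2 a_subgroup by blast

lemma coset_zero: "I +> \<zero> = I"
  by (simp add: coset_eq_zero_iff)

lemma coset_mult:
  assumes x: "x \<in> carrier R" and y: "y \<in> carrier R"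
  shows "rcoset_mult R I (I +> x) (I +> y) = I +> (x \<otimes> y)"
proof -
  have "I +> (a \<otimes> b) = I +> (x \<otimes> y)" if "a \<in> I +> x" "b \<in> I +> y" for a b
  proof -
    from that obtain h k where h: "h \<in> I" "a = h \<oplus> x" and k: "k \<in> I" "b = k \<oplus> y"
      by (auto simp: a_r_coset_def')
    then have hk: "h \<in> carrier R" "k \<in> carrier R" using a_subset by auto
    then have "a \<otimes> b \<ominus> x \<otimes> y = h \<otimes> k \<oplus> h \<otimes> y \<oplus> x \<otimes> k"
      by (simp add: h k x y nonunital_simprules)
    then show ?thesis
      using h k hk x y by (simp add: coset_eq_iff mult_closed l_absorb r_absorb)
  qed
  moreover have "x \<in> I +> x" "y \<in> I +> y"
    using x y by (simp_all add: a_rcos_self)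
  ultimately show ?thesis
    unfolding rcoset_mult_def by blast
qed

lemma quotient_simps:
  shows quotient_carrier: "carrier (R Quot I) = (+>) I ` carrier R"
    and quotient_zero: "\<zero>\<^bsub>R Quot I\<^esub> = I"
    and quotient_mult:
      "x \<in> carrier R \<Longrightarrow> y \<in> carrier R \<Longrightarrow> (I +> x) \<otimes>\<^bsub>R Quot I\<^esub> (I +> y) = I +> (x \<otimes> y)"
    and quotient_add:
      "x \<in> carrier R \<Longrightarrow> y \<in> carrier R \<Longrightarrow> (I +> x) \<oplus>\<^bsub>R Quot I\<^esub> (I +> y) = I +> (x \<oplus> y)"
  by (auto simp: FactRing_def A_RCOSETS_def' coset_mult a_rcos_sum)

lemma quotient_nonunital_ring: "nonunital_ring (R Quot I)"
proof (intro nonunital_ring.intro nonunital_ring_axioms.intro)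
  show "abelian_group (R Quot I)"
    by (rule comm_group_abelian_groupI)
      (simp add: FactRing_def a_factorgroup_is_comm_group[unfolded A_FactGroup_def'])
qed (auto simp: quotient_simps mult_closed mult_assoc mult_l_distr mult_r_distr)

lemma quotient_minus:
  assumes "x \<in> carrier R"
  shows "\<ominus>\<^bsub>R Quot I\<^esub> (I +> x) = I +> \<ominus> x"
proof -
  interpret Q: nonunital_ring "R Quot I" by (rule quotient_nonunital_ring)
  show ?thesis
    by (rule Q.minus_equality)
       (use assms in \<open>auto simp: quotient_simps l_neg coset_eq_zero_iff\<close>)
qed

end

section \<open>Compressions of an element to two-by-two matrices\<close>

text \<open>
  In comparison notation, \<open>M \<precsim> r\<close> for the two-by-two matrix \<open>M\<close>, with the index set \<open>{1,2}\<close> of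
  the definition of proper infiniteness.
\<close>

definition compression :: "('a, 'm) ring_scheme \<Rightarrow> 'a \<Rightarrow> (nat \<Rightarrow> nat \<Rightarrow> 'a) \<Rightarrow> bool"
  where "compression R r M \<longleftrightarrow> (\<exists>\<rho> \<kappa>. (\<forall>i\<in>{1,2}. \<rho> i \<in> carrier R \<and> \<kappa> i \<in> carrier R) \<and>
    (\<forall>i\<in>{1,2}. \<forall>j\<in>{1,2}. \<rho> i \<otimes>\<^bsub>R\<^esub> r \<otimes>\<^bsub>R\<^esub> \<kappa> j = M i j))"

text \<open>
  Equivalently, \<open>s\<close> is absorbed by \<open>r\<close> iff \<open>r \<oplus> s \<precsim> r\<close>.
\<close>

definition absorbed :: "('a, 'm) ring_scheme \<Rightarrow> 'a \<Rightarrow> 'a set"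
  where "absorbed R r = {s \<in> carrier R.
    compression R r (\<lambda>i j. if i \<noteq> j then \<zero>\<^bsub>R\<^esub> else if i = 1 then r else s)}"

lemma properly_infinite_iff_absorbed:
  "r \<in> carrier R \<Longrightarrow> properly_infinite R r \<longleftrightarrow> r \<noteq> \<zero>\<^bsub>R\<^esub> \<and> r \<in> absorbed R r"
  unfolding properly_infinite_def absorbed_def compression_def
  by (simp cong: if_cong)

lemma compressionI:
  assumes "\<And>i. i \<in> {1,2} \<Longrightarrow> \<rho> i \<in> carrier R" "\<And>i. i \<in> {1,2} \<Longrightarrow> \<kappa> i \<in> carrier R"
    "\<And>i j. i \<in> {1,2} \<Longrightarrow> j \<in> {1,2} \<Longrightarrow> \<rho> i \<otimes>\<^bsub>R\<^esub> r \<otimes>\<^bsub>R\<^esub> \<kappa> j = M i j"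
  shows "compression R r M"
  unfolding compression_def by (intro exI[of _ \<rho>] exI[of _ \<kappa>] conjI ballI assms)

lemma compressionE:
  assumes "compression R r M"
  obtains \<rho> \<kappa> where "\<And>i. i \<in> {1,2} \<Longrightarrow> \<rho> i \<in> carrier R" "\<And>i. i \<in> {1,2} \<Longrightarrow> \<kappa> i \<in> carrier R"
    "\<And>i j. i \<in> {1,2} \<Longrightarrow> j \<in> {1,2} \<Longrightarrow> \<rho> i \<otimes>\<^bsub>R\<^esub> r \<otimes>\<^bsub>R\<^esub> \<kappa> j = M i j"
  using assms unfolding compression_def by metis

lemma absorbedE:
  assumes "s \<in> absorbed R r"
  obtains a1 a2 b1 b2 where "a1 \<in> carrier R" "a2 \<in> carrier R" "b1 \<in> carrier R" "b2 \<in> carrier R"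
    "a1 \<otimes>\<^bsub>R\<^esub> r \<otimes>\<^bsub>R\<^esub> b1 = r" "a1 \<otimes>\<^bsub>R\<^esub> r \<otimes>\<^bsub>R\<^esub> b2 = \<zero>\<^bsub>R\<^esub>"
    "a2 \<otimes>\<^bsub>R\<^esub> r \<otimes>\<^bsub>R\<^esub> b1 = \<zero>\<^bsub>R\<^esub>" "a2 \<otimes>\<^bsub>R\<^esub> r \<otimes>\<^bsub>R\<^esub> b2 = s"
  using assms unfolding absorbed_def compression_def by auto

lemma compression_cong:
  assumes "\<And>i j. i \<in> {1,2} \<Longrightarrow> j \<in> {1,2} \<Longrightarrow> M i j = M' i j"
  shows "compression R r M \<longleftrightarrow> compression R r M'"
  unfolding compression_def using assms by auto

context nonunital_ring
begin

text \<open>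
  From \<open>M \<precsim> r\<close> and \<open>r \<oplus> s \<precsim> r\<close> one gets \<open>M \<oplus> s \<precsim> r\<close>. Adding the row and the column that
  produce \<open>s\<close> to row \<open>k\<close> and column \<open>l\<close> puts \<open>s\<close> at the position \<open>(k, l)\<close>.
\<close>

lemma compression_perturb_entry:
  assumes r: "r \<in> carrier R" and M: "compression R r M" and s: "s \<in> absorbed R r"
    and kl: "k \<in> {1,2}" "l \<in> {1,2}"
  shows "compression R r (\<lambda>i j. if i = k \<and> j = l then M i j \<oplus> s else M i j)"
proof -
  obtain \<rho> \<kappa> where \<rho>: "\<And>i. i \<in> {1,2} \<Longrightarrow> \<rho> i \<in> carrier R"
    and \<kappa>: "\<And>i. i \<in> {1,2} \<Longrightarrow> \<kappa> i \<in> carrier R"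
    and M: "\<And>i j. i \<in> {1,2} \<Longrightarrow> j \<in> {1,2} \<Longrightarrow> \<rho> i \<otimes> r \<otimes> \<kappa> j = M i j"
    by (rule compressionE[OF M], rule that)
  obtain a1 a2 b1 b2 where a: "a1 \<in> carrier R" "a2 \<in> carrier R"
    and b: "b1 \<in> carrier R" "b2 \<in> carrier R"
    and ab: "a1 \<otimes> r \<otimes> b1 = r" "a1 \<otimes> r \<otimes> b2 = \<zero>" "a2 \<otimes> r \<otimes> b1 = \<zero>" "a2 \<otimes> r \<otimes> b2 = s"
    by (rule absorbedE[OF s])
  have ab_mult: "a1 \<otimes> (r \<otimes> (b1 \<otimes> x)) = r \<otimes> x" "a2 \<otimes> (r \<otimes> (b1 \<otimes> x)) = \<zero>" if "x \<in> carrier R" for x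
    using arg_cong[OF ab(1), of "\<lambda>y. y \<otimes> x"] arg_cong[OF ab(3), of "\<lambda>y. y \<otimes> x"] a b r that
    by (simp_all add: mult_closed mult_assoc)
  have ab': "a1 \<otimes> (r \<otimes> b2) = \<zero>" "a2 \<otimes> (r \<otimes> b2) = s"
    using ab a b r by (simp_all add: mult_assoc)
  define \<rho>' where "\<rho>' i = \<rho> i \<otimes> a1 \<oplus> (if i = k then a2 else \<zero>)" for i
  define \<kappa>' where "\<kappa>' j = b1 \<otimes> \<kappa> j \<oplus> (if j = l then b2 else \<zero>)" for j
  have "\<rho>' i \<otimes> r \<otimes> \<kappa>' j = (if i = k \<and> j = l then M i j \<oplus> s else M i j)"
    if ij: "i \<in> {1,2}" "j \<in> {1,2}" for i j
  proof -
    have "s \<in> carrier R" using s by (simp add: absorbed_def)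
    then show ?thesis
      unfolding \<rho>'_def \<kappa>'_def M[OF ij, symmetric]
      using \<rho>[OF ij(1)] \<kappa>[OF ij(2)] \<rho>[OF kl(1)] \<kappa>[OF kl(2)] a b r
      by (simp add: mult_closed mult_assoc mult_l_distr mult_r_distr ab_mult ab')
  qed
  moreover have "\<rho>' i \<in> carrier R" "\<kappa>' i \<in> carrier R" if "i \<in> {1,2}" for i
    using \<rho>[OF that] \<kappa>[OF that] a b unfolding \<rho>'_def \<kappa>'_def by (simp_all add: mult_closed)
  ultimately show ?thesis
    by (intro compressionI)
qed

text \<open>
  Consequently it suffices to realise a matrix modulo the absorbed elements.
\<close>

lemma compression_perturb:
  assumes r: "r \<in> carrier R" and M: "compression R r M"
    and Mc: "\<And>i j. i \<in> {1,2} \<Longrightarrow> j \<in> {1,2} \<Longrightarrow> M i j \<in> carrier R"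
    and Mc': "\<And>i j. i \<in> {1,2} \<Longrightarrow> j \<in> {1,2} \<Longrightarrow> M' i j \<in> carrier R"
    and d: "\<And>i j. i \<in> {1,2} \<Longrightarrow> j \<in> {1,2} \<Longrightarrow> M' i j \<ominus> M i j \<in> absorbed R r"
  shows "compression R r M'"
proof -
  have *: "M i j \<oplus> (M' i j \<ominus> M i j) = M' i j" if "i \<in> {1,2}" "j \<in> {1,2}" for i j
    using Mc[OF that] Mc'[OF that] by (simp add: minus_eq a_lcomm[of "M i j"] r_neg)
  have 1: "(1::nat) \<in> {1,2}" and 2: "(2::nat) \<in> {1,2}" by auto
  note p = compression_perturb_entry[OF r]
  show ?thesis
    by (rule iffD1[OF compression_cong p[OF p[OF p[OF p[OF M d[OF 1 1] 1 1] d[OF 1 2] 1 2]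
          d[OF 2 1] 2 1] d[OF 2 2] 2 2]]) (auto simp: *)
qed

text \<open>
  Closure under sums is the case \<open>k = l = 2\<close> of the perturbation lemma. Multiplication of the
  second row or of the second column by a ring element gives the closure under products. The local
  units of \<open>r\<close> are there to realise \<open>diag(r, 0)\<close>.
\<close>

lemma absorbed_ideal:
  assumes r: "r \<in> carrier R" and u: "u \<in> carrier R" "u \<otimes> r = r" and v: "v \<in> carrier R" "r \<otimes> v = r"
  shows "two_sided_ideal (absorbed R r) R"
proof -
  have zero: "\<zero> \<in> absorbed R r"
    unfolding absorbed_def compression_def mem_Collect_eq
    by (rule conjI, simp, rule exI[of _ "\<lambda>i. if i = 1 then u else \<zero>"],
        rule exI[of _ "\<lambda>i. if i = 1 then v else \<zero>"]) (use assms in auto)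
  have add: "s \<oplus> t \<in> absorbed R r" if st: "s \<in> absorbed R r" "t \<in> absorbed R r" for s t
  proof -
    have c: "s \<in> carrier R" "t \<in> carrier R" using st by (auto simp: absorbed_def)
    have "compression R r (\<lambda>i j. if i \<noteq> j then \<zero> else if i = 1 then r else s)"
      using st by (simp add: absorbed_def)
    from compression_perturb_entry[OF r this st(2), of 2 2]
    have "compression R r (\<lambda>i j. if i \<noteq> j then \<zero> else if i = 1 then r else s \<oplus> t)"
      by (rule iffD1[OF compression_cong, rotated]) auto
    then show ?thesis using c by (simp add: absorbed_def)
  qed
  have left: "x \<otimes> s \<in> absorbed R r" and right: "s \<otimes> x \<in> absorbed R r"
    if s: "s \<in> absorbed R r" and x: "x \<in> carrier R" for s x
  proof -
    obtain a1 a2 b1 b2 where a: "a1 \<in> carrier R" "a2 \<in> carrier R"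
      and b: "b1 \<in> carrier R" "b2 \<in> carrier R"
      and ab: "a1 \<otimes> r \<otimes> b1 = r" "a1 \<otimes> r \<otimes> b2 = \<zero>" "a2 \<otimes> r \<otimes> b1 = \<zero>" "a2 \<otimes> r \<otimes> b2 = s"
      by (rule absorbedE[OF s])
    have "s \<in> carrier R" using s by (simp add: absorbed_def)
    then have xs: "x \<otimes> s \<in> carrier R" "s \<otimes> x \<in> carrier R"
      using x by (simp_all add: mult_closed)
    have ab': "a1 \<otimes> (r \<otimes> b1) = r" "a1 \<otimes> (r \<otimes> b2) = \<zero>" "a2 \<otimes> (r \<otimes> b1) = \<zero>" "a2 \<otimes> (r \<otimes> b2) = s"
      using ab a b r by (simp_all add: mult_assoc)
    have mult_x: "a1 \<otimes> (r \<otimes> (b2 \<otimes> x)) = \<zero>" "a2 \<otimes> (r \<otimes> (b2 \<otimes> x)) = s \<otimes> x"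
      using arg_cong[OF ab(2), of "\<lambda>y. y \<otimes> x"] arg_cong[OF ab(4), of "\<lambda>y. y \<otimes> x"] a b r x
      by (simp_all add: mult_closed mult_assoc)
    show "x \<otimes> s \<in> absorbed R r"
      unfolding absorbed_def compression_def mem_Collect_eq
      by (rule conjI, rule xs, rule exI[of _ "\<lambda>i. if i = 1 then a1 else x \<otimes> a2"],
          rule exI[of _ "\<lambda>i. if i = 1 then b1 else b2"])
         (use r a b x in \<open>auto simp: mult_closed mult_assoc ab'\<close>)
    show "s \<otimes> x \<in> absorbed R r"
      unfolding absorbed_def compression_def mem_Collect_eq
      by (rule conjI, rule xs, rule exI[of _ "\<lambda>i. if i = 1 then a1 else a2"],
          rule exI[of _ "\<lambda>i. if i = 1 then b1 else b2 \<otimes> x"])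
         (use r a b x in \<open>auto simp: mult_closed mult_assoc ab' mult_x\<close>)
  qed
  have minus: "\<ominus> s \<in> absorbed R r" if s: "s \<in> absorbed R r" for s
  proof -
    have c: "s \<in> carrier R" using s by (simp add: absorbed_def)
    obtain a1 a2 b1 b2 where a: "a1 \<in> carrier R" "a2 \<in> carrier R"
      and b: "b1 \<in> carrier R" "b2 \<in> carrier R"
      and ab: "a1 \<otimes> r \<otimes> b1 = r" "a1 \<otimes> r \<otimes> b2 = \<zero>" "a2 \<otimes> r \<otimes> b1 = \<zero>" "a2 \<otimes> r \<otimes> b2 = s"
      by (rule absorbedE[OF s])
    show ?thesis
      unfolding absorbed_def compression_def mem_Collect_eq
      by (rule conjI, use c in simp, rule exI[of _ "\<lambda>i. if i = 1 then a1 else \<ominus> a2"],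
          rule exI[of _ "\<lambda>i. if i = 1 then b1 else b2"])
         (use r a b ab in \<open>auto simp: mult_closed minus_mult minus_zero\<close>)
  qed
  have "subgroup (absorbed R r) (add_monoid R)"
    by (rule add.subgroupI) (use zero add minus in \<open>auto simp: absorbed_def\<close>)
  then show ?thesis
    by (intro two_sided_ideal.intro additive_subgroup.intro two_sided_ideal_axioms.intro left right)
qed

text \<open>
  Modulo the ideal of absorbed elements, nothing but \<open>0\<close> is absorbed: lift the rows and columns
  arbitrarily, and correct the resulting matrix with the perturbation lemma.
\<close>

lemma absorbed_quotient:
  assumes r: "r \<in> carrier R" and s: "s \<in> carrier R" and T: "two_sided_ideal (absorbed R r) R"
    and abs: "absorbed R r +> s \<in> absorbed (R Quot absorbed R r) (absorbed R r +> r)"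
  shows "s \<in> absorbed R r"
proof -
  define T where "T = absorbed R r"
  interpret T: nonunital_ideal T R
    using T by (intro nonunital_ideal.intro nonunital_ring_axioms) (simp add: T_def)
  interpret Q: nonunital_ring "R Quot T" by (rule T.quotient_nonunital_ring)
  have "compression (R Quot T) (T +> r)
      (\<lambda>i j. if i \<noteq> j then \<zero>\<^bsub>R Quot T\<^esub> else if i = 1 then T +> r else T +> s)"
    using abs unfolding T_def absorbed_def[of "R Quot absorbed R r"] by blast
  then obtain \<rho> \<kappa> where \<rho>\<kappa>: "\<And>i. i \<in> {1,2} \<Longrightarrow> \<rho> i \<in> carrier (R Quot T)" "\<And>i. i \<in> {1,2} \<Longrightarrow> \<kappa> i \<in> carrier (R Quot T)"
    and prod: "\<And>i j::nat. i \<in> {1,2} \<Longrightarrow> j \<in> {1,2} \<Longrightarrow> \<rho> i \<otimes>\<^bsub>R Quot T\<^esub> (T +> r) \<otimes>\<^bsub>R Quot T\<^esub> \<kappa> j =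
      (if i \<noteq> j then \<zero>\<^bsub>R Quot T\<^esub> else if i = 1 then T +> r else T +> s)"
    by (rule compressionE) (rule that)
  have "\<forall>i\<in>{1,2}. \<exists>x y. x \<in> carrier R \<and> y \<in> carrier R \<and> \<rho> i = T +> x \<and> \<kappa> i = T +> y"
  proof
    fix i :: nat assume "i \<in> {1,2}"
    then have "\<rho> i \<in> (+>) T ` carrier R" "\<kappa> i \<in> (+>) T ` carrier R"
      using \<rho>\<kappa>(1)[of i] \<rho>\<kappa>(2)[of i] by (simp_all add: T.quotient_carrier)
    then show "\<exists>x y. x \<in> carrier R \<and> y \<in> carrier R \<and> \<rho> i = T +> x \<and> \<kappa> i = T +> y"
      by blast
  qed
  then obtain x y where xy: "\<And>i. i \<in> {1,2} \<Longrightarrow> x i \<in> carrier R \<and> y i \<in> carrier R"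
    and lift: "\<And>i. i \<in> {1,2} \<Longrightarrow> \<rho> i = T +> x i \<and> \<kappa> i = T +> y i"
    by metis
  define M where "M i j = x i \<otimes> r \<otimes> y j" for i j
  let ?D = "\<lambda>i j. if i \<noteq> j then \<zero> else if i = (1::nat) then r else s"
  have M: "compression R r M"
    unfolding compression_def M_def using xy by blast
  have "compression R r ?D"
  proof (rule compression_perturb[OF r M])
    fix i j :: nat assume ij: "i \<in> {1,2}" "j \<in> {1,2}"
    show c: "M i j \<in> carrier R" "?D i j \<in> carrier R"
      using xy[OF ij(1)] xy[OF ij(2)] r s by (auto simp: M_def mult_closed)
    have "T +> M i j = \<rho> i \<otimes>\<^bsub>R Quot T\<^esub> (T +> r) \<otimes>\<^bsub>R Quot T\<^esub> \<kappa> j"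
      using xy[OF ij(1)] xy[OF ij(2)] r lift[OF ij(1)] lift[OF ij(2)]
      by (simp add: M_def T.quotient_mult mult_closed)
    also have "\<dots> = T +> ?D i j"
      unfolding prod[OF ij] by (simp add: T.quotient_zero T.coset_zero)
    finally have "T +> M i j = T +> ?D i j" .
    then show "?D i j \<ominus> M i j \<in> absorbed R r"
      using T.coset_eq_iff[OF c(2,1)] unfolding T_def[symmetric] by simp
  qed
  then show ?thesis
    using s by (simp add: absorbed_def)
qed

text \<open>
  Choose \<open>p, q\<close> with \<open>p r q = E\<close>, \<open>E p = p\<close> and \<open>q E = q\<close>. Then \<open>r = r' + r q p r\<close> with
  \<open>r' = \<gamma> r \<delta>\<close>, where \<open>\<gamma> = u - r q p\<close> and \<open>\<delta> = v - q p r\<close> take the place of \<open>1 - r q p\<close> and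
  \<open>1 - q p r\<close>. The summands are orthogonal: \<open>\<gamma> r q = 0 = p r \<delta>\<close>. Hence \<open>r\<close> is equivalent to
  \<open>r' \<oplus> E\<close>. Since \<open>E\<close> absorbs a second copy of \<open>E\<close>, so does \<open>r\<close>: the first row and column rebuild
  \<open>r\<close> from \<open>r'\<close> and the copy \<open>a1 E b1\<close>, and the second ones produce the copy \<open>a2 E b2\<close>.
\<close>

lemma idempotent_absorbed:
  assumes carr: "r \<in> carrier R" "E \<in> carrier R" "\<alpha> \<in> carrier R" "\<beta> \<in> carrier R"
      "a1 \<in> carrier R" "a2 \<in> carrier R" "b1 \<in> carrier R" "b2 \<in> carrier R"
      "u \<in> carrier R" "v \<in> carrier R"
    and E: "E \<otimes> E = E" "\<alpha> \<otimes> r \<otimes> \<beta> = E"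
    and unit: "u \<otimes> r = r" "r \<otimes> v = r"
    and inf: "a1 \<otimes> E \<otimes> b1 = E" "a1 \<otimes> E \<otimes> b2 = \<zero>" "a2 \<otimes> E \<otimes> b1 = \<zero>" "a2 \<otimes> E \<otimes> b2 = E"
  shows "E \<in> absorbed R r"
proof -
  define p q where "p = E \<otimes> \<alpha>" and "q = \<beta> \<otimes> E"
  have pq: "p \<in> carrier R" "q \<in> carrier R"
    using carr by (simp_all add: p_def q_def mult_closed)
  have cut: "y \<otimes> (z \<otimes> x) = t \<otimes> x"
    if "y \<otimes> z = t" "x \<in> carrier R" "y \<in> carrier R" "z \<in> carrier R" for x y z t
    using that by (metis mult_assoc)
  have cut3: "y \<otimes> (z \<otimes> (w \<otimes> x)) = t \<otimes> x"
    if "y \<otimes> z \<otimes> w = t" "x \<in> carrier R" "y \<in> carrier R" "z \<in> carrier R" "w \<in> carrier R" for x y z w t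
    using that by (metis mult_assoc mult_closed)
  have EE: "E \<otimes> (E \<otimes> x) = E \<otimes> x" if "x \<in> carrier R" for x
    using cut[OF E(1)] that carr by blast
  have "E \<otimes> (\<alpha> \<otimes> (r \<otimes> (\<beta> \<otimes> E))) = E"
    using cut3[OF E(2), of E] carr E(1) EE by simp
  then have prq: "p \<otimes> r \<otimes> q = E"
    using carr by (simp add: p_def q_def mult_assoc mult_closed)
  have Ep: "E \<otimes> p = p" and qE: "q \<otimes> E = q"
    using carr E by (simp_all add: p_def q_def mult_assoc mult_closed EE)
  define \<gamma> \<delta> where "\<gamma> = u \<ominus> r \<otimes> q \<otimes> p" and "\<delta> = v \<ominus> q \<otimes> p \<otimes> r"
  have gd: "\<gamma> \<in> carrier R" "\<delta> \<in> carrier R"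
    using carr pq by (simp_all add: \<gamma>_def \<delta>_def mult_closed)
  have prq': "p \<otimes> (r \<otimes> q) = E"
    using prq carr pq by (simp add: mult_assoc)
  have \<gamma>r: "\<gamma> \<otimes> r = r \<ominus> r \<otimes> (q \<otimes> (p \<otimes> r))"
    using carr pq unit by (simp add: \<gamma>_def nonunital_simprules)
  have r\<delta>: "r \<otimes> \<delta> = r \<ominus> r \<otimes> (q \<otimes> (p \<otimes> r))"
    using carr pq unit by (simp add: \<delta>_def nonunital_simprules)
  have \<gamma>rq: "\<gamma> \<otimes> r \<otimes> q = \<zero>"
    unfolding \<gamma>r using carr pq by (simp add: nonunital_simprules prq' qE)
  have pr\<delta>: "p \<otimes> (r \<otimes> \<delta>) = \<zero>"
    unfolding r\<delta> using carr pq by (simp add: nonunital_simprules cut3[OF prq] cut[OF Ep])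
  have \<gamma>r\<delta>: "\<gamma> \<otimes> (r \<otimes> \<delta>) = r \<ominus> r \<otimes> (q \<otimes> (p \<otimes> r))"
  proof -
    have "\<gamma> \<otimes> (r \<otimes> x) = r \<otimes> x \<ominus> r \<otimes> (q \<otimes> (p \<otimes> (r \<otimes> x)))" if "x \<in> carrier R" for x
      using carr pq gd that unfolding mult_assoc[symmetric, OF gd(1) carr(1) that] \<gamma>r
      by (simp add: mult_closed mult_assoc mult_l_distr minus_eq minus_mult)
    then have "\<gamma> \<otimes> (r \<otimes> \<delta>) = r \<otimes> \<delta> \<ominus> r \<otimes> (q \<otimes> (p \<otimes> (r \<otimes> \<delta>)))"
      using gd by blast
    also have "\<dots> = r \<otimes> \<delta>"
      using carr pq gd by (simp add: pr\<delta> minus_eq minus_zero mult_closed)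
    finally show ?thesis by (simp only: r\<delta>)
  qed
  note simps = cut3[OF prq] cut3[OF \<gamma>rq] prq' \<gamma>rq[simplified mult_assoc gd carr pq] pr\<delta> \<gamma>r\<delta>
    cut[OF Ep] cut[OF qE] Ep qE cut3[OF inf(1)] cut3[OF inf(2)] cut3[OF inf(3)] cut3[OF inf(4)]
    inf[simplified mult_assoc carr]
  let ?\<rho> = "\<lambda>i. if i = (1::nat) then \<gamma> \<oplus> r \<otimes> q \<otimes> a1 \<otimes> p else a2 \<otimes> p"
  let ?\<kappa> = "\<lambda>i. if i = (1::nat) then \<delta> \<oplus> q \<otimes> b1 \<otimes> p \<otimes> r else q \<otimes> b2"
  have "(\<gamma> \<oplus> r \<otimes> q \<otimes> a1 \<otimes> p) \<otimes> r \<otimes> (\<delta> \<oplus> q \<otimes> b1 \<otimes> p \<otimes> r) = r"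
    "(\<gamma> \<oplus> r \<otimes> q \<otimes> a1 \<otimes> p) \<otimes> r \<otimes> (q \<otimes> b2) = \<zero>"
    "a2 \<otimes> p \<otimes> r \<otimes> (\<delta> \<oplus> q \<otimes> b1 \<otimes> p \<otimes> r) = \<zero>"
    "a2 \<otimes> p \<otimes> r \<otimes> (q \<otimes> b2) = E"
    using carr pq gd by (simp_all add: mult_closed mult_assoc mult_l_distr mult_r_distr simps
        minus_eq a_assoc l_neg)
  then show ?thesis
    unfolding absorbed_def compression_def mem_Collect_eq
    using carr pq gd
    by (intro conjI exI[of _ ?\<rho>] exI[of _ ?\<kappa>]) (auto simp: mult_closed)
qed

end

section \<open>Rings spanned by coefficients times words in the Leavitt generators\<close>

lemma (in nonunital_ring) finsum_mult_both:
  assumes "finite F" "\<And>p. p \<in> F \<Longrightarrow> f p \<in> carrier R" "x \<in> carrier R" "y \<in> carrier R"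
  shows "x \<otimes> finsum R f F \<otimes> y = (\<Oplus>p\<in>F. x \<otimes> f p \<otimes> y)"
  using assms(1,2)
proof (induction F rule: finite_induct)
  case empty
  then show ?case using assms by simp
next
  case (insert p F)
  then have "f \<in> F \<rightarrow> carrier R" "(\<lambda>p. x \<otimes> f p \<otimes> y) \<in> F \<rightarrow> carrier R"
    using assms by (auto simp: mult_closed)
  then show ?case
    using insert assms by (simp add: mult_closed mult_l_distr mult_r_distr)
qed

text \<open>
  Tominaga's argument: a unit \<open>u\<close> for \<open>S\<close> is improved to one for \<open>x\<close> as well by the circle
  composition \<open>u' + u - u' u\<close> with a unit \<open>u'\<close> of the defect \<open>x - u x\<close>.
\<close>

lemma (in s_unital_ring) common_local_units:
  assumes "finite S" "S \<subseteq> carrier R"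
  shows "\<exists>u\<in>carrier R. \<exists>v\<in>carrier R. \<forall>x\<in>S. u \<otimes> x = x \<and> x \<otimes> v = x"
  using assms
proof (induction S rule: finite_induct)
  case empty
  then show ?case by auto
next
  case (insert x S)
  then obtain u v where uv: "u \<in> carrier R" "v \<in> carrier R"
    and S: "\<And>y. y \<in> S \<Longrightarrow> u \<otimes> y = y \<and> y \<otimes> v = y" and x: "x \<in> carrier R"
    by auto
  obtain u' where u': "u' \<in> carrier R" "u' \<otimes> (x \<ominus> u \<otimes> x) = x \<ominus> u \<otimes> x"
    using s_unital[of "x \<ominus> u \<otimes> x"] uv x by (auto simp: mult_closed)
  obtain v' where v': "v' \<in> carrier R" "(x \<ominus> x \<otimes> v) \<otimes> v' = x \<ominus> x \<otimes> v"
    using s_unital[of "x \<ominus> x \<otimes> v"] uv x by (auto simp: mult_closed)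
  let ?u = "u' \<oplus> (u \<ominus> u' \<otimes> u)" and ?v = "v' \<oplus> (v \<ominus> v \<otimes> v')"
  have "?u \<otimes> x = u' \<otimes> (x \<ominus> u \<otimes> x) \<oplus> u \<otimes> x" "x \<otimes> ?v = (x \<ominus> x \<otimes> v) \<otimes> v' \<oplus> x \<otimes> v"
    using uv u'(1) v'(1) x by (simp_all add: nonunital_simprules)
  then have "?u \<otimes> x = x" "x \<otimes> ?v = x"
    using u' v' uv x by (simp_all add: mult_closed minus_eq a_assoc l_neg)
  moreover have "?u \<otimes> y = y" "y \<otimes> ?v = y" if "y \<in> S" for y
  proof -
    have y: "y \<in> carrier R" using that insert by auto
    then have "?u \<otimes> y = u' \<otimes> y \<oplus> (u \<otimes> y \<ominus> u' \<otimes> (u \<otimes> y))"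
        "y \<otimes> ?v = y \<otimes> v' \<oplus> (y \<otimes> v \<ominus> (y \<otimes> v) \<otimes> v')"
      using uv u'(1) v'(1) by (simp_all add: nonunital_simprules)
    then show "?u \<otimes> y = y" "y \<otimes> ?v = y"
      using S[OF that] y uv u'(1) v'(1) by (simp_all add: nonunital_simprules)
  qed
  ultimately show ?case
    using uv u'(1) v'(1) by (intro bexI[of _ ?u] bexI[of _ ?v]) (auto simp: mult_closed)
qed

text \<open>
  The element \<open>t a w\<close> plays the role of \<open>a \<otimes> w\<close>. As \<open>A\<close> need not have a unit, the words themselves
  are not elements of \<open>R\<close>. That the \<open>a \<otimes> w\<close> generate \<open>R\<close> additively is stated as an induction rule.
\<close>

locale leavitt_span = A: s_unital_ring A + nonunital_ring R
  for A :: "('a, 'm) ring_scheme" and R :: "('r, 'n) ring_scheme" (structure) +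
  fixes t :: "'a \<Rightarrow> leavitt_gen list \<Rightarrow> 'r"
  assumes t_closed: "a \<in> carrier A \<Longrightarrow> t a w \<in> carrier R"
    and t_add: "a \<in> carrier A \<Longrightarrow> b \<in> carrier A \<Longrightarrow> t (a \<oplus>\<^bsub>A\<^esub> b) w = t a w \<oplus> t b w"
    and t_mult: "a \<in> carrier A \<Longrightarrow> b \<in> carrier A \<Longrightarrow> t a w \<otimes> t b w' = t (a \<otimes>\<^bsub>A\<^esub> b) (w @ w')"
    and t_XY: "a \<in> carrier A \<Longrightarrow> t a (w @ X i # Y j # w') = (if i = j then t a (w @ w') else \<zero>)"
    and t_induct: "\<lbrakk>x \<in> carrier R; \<And>a w. a \<in> carrier A \<Longrightarrow> P (t a w);
      \<And>x y. x \<in> carrier R \<Longrightarrow> y \<in> carrier R \<Longrightarrow> P x \<Longrightarrow> P y \<Longrightarrow> P (x \<oplus> y)\<rbrakk> \<Longrightarrow> P x"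
begin

lemma t_zero: "t \<zero>\<^bsub>A\<^esub> w = \<zero>"
  using t_add[of "\<zero>\<^bsub>A\<^esub>" "\<zero>\<^bsub>A\<^esub>" w] t_closed[of "\<zero>\<^bsub>A\<^esub>" w]
  by (metis A.zero_closed A.l_zero add.l_cancel_one')

lemma t_eq_zero:
  assumes "a \<in> carrier A" "t a [] = \<zero>"
  shows "t a w = \<zero>"
proof -
  obtain v where v: "v \<in> carrier A" "a \<otimes>\<^bsub>A\<^esub> v = a"
    using A.s_unital assms by blast
  then have "t a w = t a [] \<otimes> t v w"
    using t_mult[of a v "[]" w] assms(1) by simp
  then show ?thesis
    using assms v by (simp add: t_closed)
qed

lemma t_Cons:
  assumes "a \<in> carrier A" 
  obtains u where "u \<in> carrier A" "\<And>w. t a (g # w) = t u [g] \<otimes> t a w"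
proof -
  obtain u where "u \<in> carrier A" "u \<otimes>\<^bsub>A\<^esub> a = a"
    using A.s_unital assms by blast
  with that[of u] assms show thesis by (simp add: t_mult)
qed

text \<open>
  The ring \<open>R\<close> is s-unital: for a sum of terms \<open>a \<otimes> w\<close>, take \<open>u \<otimes> 1\<close> with \<open>u\<close> a common unit of the
  coefficients. The set \<open>S\<close> in the proof collects these coefficients.
\<close>

lemma local_units:
  assumes "r \<in> carrier R"
  obtains u v where "u \<in> carrier R" "v \<in> carrier R" "u \<otimes> r = r" "r \<otimes> v = r"
proof -
  define P where "P x S \<longleftrightarrow> (\<forall>u\<in>carrier A. (\<forall>s\<in>S. u \<otimes>\<^bsub>A\<^esub> s = s) \<longrightarrow> t u [] \<otimes> x = x) \<and>
      (\<forall>v\<in>carrier A. (\<forall>s\<in>S. s \<otimes>\<^bsub>A\<^esub> v = s) \<longrightarrow> x \<otimes> t v [] = x)" for x S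
  have "\<exists>S. finite S \<and> S \<subseteq> carrier A \<and> P r S"
    using assms
  proof (rule t_induct)
    fix a w assume "a \<in> carrier A"
    then show "\<exists>S. finite S \<and> S \<subseteq> carrier A \<and> P (t a w) S"
      by (intro exI[of _ "{a}"]) (simp add: P_def t_mult)
  next
    fix x y assume xy: "x \<in> carrier R" "y \<in> carrier R"
      and "\<exists>S. finite S \<and> S \<subseteq> carrier A \<and> P x S" "\<exists>S. finite S \<and> S \<subseteq> carrier A \<and> P y S"
    then obtain S S' where "finite S" "S \<subseteq> carrier A" "P x S" "finite S'" "S' \<subseteq> carrier A" "P y S'"
      by auto
    then show "\<exists>S. finite S \<and> S \<subseteq> carrier A \<and> P (x \<oplus> y) S"
      using xy
      by (intro exI[of _ "S \<union> S'"]) (simp add: P_def t_closed mult_l_distr mult_r_distr)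
  qed
  then obtain S where S: "finite S" "S \<subseteq> carrier A" "P r S"
    by blast
  then obtain u v where "u \<in> carrier A" "v \<in> carrier A" "\<forall>x\<in>S. u \<otimes>\<^bsub>A\<^esub> x = x \<and> x \<otimes>\<^bsub>A\<^esub> v = x"
    using A.common_local_units by blast
  with S(3) that[of "t u []" "t v []"] show thesis
    by (simp add: P_def t_closed)
qed

text \<open>
  The pair \<open>(\<mu>, \<nu>)\<close> stands for \<open>y\<^sub>\<mu> x\<^sub>\<nu>\<close>. The second component is reversed because the letters of
  \<open>x\<^sub>\<nu> y\<^sub>\<nu>\<close> cancel from the inside out, so that \<open>x\<^sub>\<nu>\<close> is a left inverse of \<open>y\<^sub>\<nu>\<close>, and so that
  comparing \<open>x\<^sub>\<nu>\<close> with \<open>y\<^sub>\<mu>\<close> amounts to comparing prefixes.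
\<close>

abbreviation normal_word :: "nat list \<times> nat list \<Rightarrow> leavitt_gen list"
  where "normal_word p \<equiv> map Y (fst p) @ map X (rev (snd p))"

lemma normal_form:
  "(\<forall>a\<in>carrier A. t a w = \<zero>) \<or> (\<exists>p. \<forall>a\<in>carrier A. t a w = t a (normal_word p))"
proof (induction w)
  case Nil
  have "t a [] = t a (normal_word ([], []))" for a by simp
  then show ?case by blast
next
  case (Cons g w)
  show ?case
  proof (cases "\<forall>a\<in>carrier A. t a w = \<zero>")
    case True
    have "t a (g # w) = \<zero>" if a: "a \<in> carrier A" for a
      using t_Cons[OF a, of g] True a by (metis mult_zero t_closed)
    then show ?thesis by blast
  next
    case False
    then obtain p where p: "\<And>a. a \<in> carrier A \<Longrightarrow> t a w = t a (normal_word p)"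
      using Cons.IH by blast
    have eq: "t a (g # w) = t a (g # normal_word p)" if a: "a \<in> carrier A" for a
      using t_Cons[OF a, of g] p[OF a] by metis
    show ?thesis
    proof (cases g)
      case (Y i)
      then have "g # normal_word p = normal_word (i # fst p, snd p)" by simp
      then show ?thesis using eq by metis
    next
      case (X i)
      show ?thesis
      proof (cases "fst p")
        case Nil
        then have "g # normal_word p = normal_word ([], snd p @ [i])" using X by simp
        then show ?thesis using eq by metis
      next
        case (Cons j \<mu>)
        then have w: "g # normal_word p = [] @ leavitt_gen.X i # leavitt_gen.Y j # normal_word (\<mu>, snd p)"
          using X by simp
        have "t a (g # w) = (if i = j then t a (normal_word (\<mu>, snd p)) else \<zero>)"
          if "a \<in> carrier A" for a
          using eq[OF that] t_XY[OF that, of "[]" i j] unfolding w by simp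
        then show ?thesis
          by (cases "i = j") auto
      qed
    qed
  qed
qed

text \<open>
  Collecting equal monomials matters: the sum runs over distinct pairs \<open>p\<close>. In the proof, the
  coefficients vanish outside of \<open>F\<close>, so that two sums can be brought to the same index set.
\<close>

lemma finite_normal_form:
  assumes "r \<in> carrier R"
  obtains F c where "finite F" "\<And>p. c p \<in> carrier A" "r = (\<Oplus>p\<in>F. t (c p) (normal_word p))"
proof -
  define rep where "rep x F c \<longleftrightarrow> finite F \<and> (\<forall>p. c p \<in> carrier A) \<and> (\<forall>p. p \<notin> F \<longrightarrow> c p = \<zero>\<^bsub>A\<^esub>) \<and>
    x = (\<Oplus>p\<in>F. t (c p) (normal_word p))" for x F c
  have "\<exists>F c. rep r F c"
    using assms
  proof (rule t_induct)
    fix a w assume a: "a \<in> carrier A"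
    show "\<exists>F c. rep (t a w) F c"
    proof (cases "t a w = \<zero>")
      case True
      then have "rep (t a w) {} (\<lambda>p. \<zero>\<^bsub>A\<^esub>)" by (simp add: rep_def)
      then show ?thesis by blast
    next
      case False
      then obtain p where "t a w = t a (normal_word p)"
        using normal_form a by blast
      then have "rep (t a w) {p} (\<lambda>q. if q = p then a else \<zero>\<^bsub>A\<^esub>)"
        using a t_closed by (simp add: rep_def)
      then show ?thesis by blast
    qed
  next
    fix x y assume "\<exists>F c. rep x F c" "\<exists>F c. rep y F c"
    then obtain F c G d where F: "rep x F c" and G: "rep y G d" by blast
    have ext: "rep x (F \<union> G) c" if "rep x F c" "finite G" for x F G c
    proof -
      have "(\<Oplus>p\<in>F. t (c p) (normal_word p)) = (\<Oplus>p\<in>F \<union> G. t (c p) (normal_word p))"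
        by (rule add.finprod_mono_neutral_cong_left)
          (use that in \<open>auto simp: rep_def t_zero t_closed\<close>)
      then show ?thesis using that by (simp add: rep_def)
    qed
    have "rep x (F \<union> G) c" "rep y (F \<union> G) d"
      using ext[OF F, of G] ext[OF G, of F] F G by (simp_all add: rep_def Un_commute)
    moreover from this have "c p \<in> carrier A" "d p \<in> carrier A" for p
      unfolding rep_def by blast+
    ultimately have "rep (x \<oplus> y) (F \<union> G) (\<lambda>p. c p \<oplus>\<^bsub>A\<^esub> d p)"
      by (simp add: rep_def t_add finsum_addf t_closed Pi_def del: split_paired_All)
    then show "\<exists>F c. rep (x \<oplus> y) F c" by blast
  qed
  then show thesis using that unfolding rep_def by blast
qed

lemma t_cancel:
  "a \<in> carrier A \<Longrightarrow> t a (w @ map X (rev \<nu>) @ map Y \<nu> @ w') = t a (w @ w')"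
proof (induction \<nu> arbitrary: w')
  case (Cons i \<nu>)
  have "t a (w @ map X (rev (i # \<nu>)) @ map Y (i # \<nu>) @ w') =
      t a ((w @ map X (rev \<nu>)) @ X i # Y i # (map Y \<nu> @ w'))"
    by simp
  also have "\<dots> = t a (w @ map X (rev \<nu>) @ map Y \<nu> @ w')"
    using t_XY[OF Cons.prems, of "w @ map X (rev \<nu>)" i i] by simp
  finally show ?case using Cons by simp
qed simp

text \<open>
  At the first position where \<open>\<nu>\<close> and \<open>\<mu>\<close> differ, a factor \<open>x\<^sub>i y\<^sub>j = 0\<close> with \<open>i \<noteq> j\<close> appears.
\<close>

lemma t_incomparable:
  assumes "a \<in> carrier A" "\<not> prefix \<nu> \<mu>" "\<not> prefix \<mu> \<nu>"
  shows "t a (w @ map X (rev \<nu>) @ map Y \<mu> @ w') = \<zero>"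
proof -
  obtain \<sigma> i \<nu>' j \<mu>' where ij: "i \<noteq> j" and \<nu>: "\<nu> = \<sigma> @ i # \<nu>'" and \<mu>: "\<mu> = \<sigma> @ j # \<mu>'"
    using parallel_decomp[of \<nu> \<mu>] assms by (auto simp: parallel_def)
  have "t a (w @ map X (rev \<nu>) @ map Y \<mu> @ w') =
      t a ((w @ map X (rev \<nu>') @ [X i]) @ map X (rev \<sigma>) @ map Y \<sigma> @ (Y j # map Y \<mu>' @ w'))"
    by (simp add: \<nu> \<mu>)
  also have "\<dots> = t a ((w @ map X (rev \<nu>')) @ X i # Y j # (map Y \<mu>' @ w'))"
    using t_cancel[OF assms(1), of "w @ map X (rev \<nu>') @ [X i]" \<sigma> "Y j # map Y \<mu>' @ w'"]
    by simp
  finally show ?thesis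
    using t_XY[OF assms(1), of "w @ map X (rev \<nu>')" i j "map Y \<mu>' @ w'"] ij by simp
qed

text \<open>
  The product \<open>x\<^sub>N x\<^sub>\<mu> y\<^sub>\<mu>\<^sub>' x\<^sub>\<nu>\<^sub>' y\<^sub>\<nu> y\<^sub>N\<close> is \<open>0\<close> unless \<open>\<mu>'\<close> is a prefix of \<open>\<mu>\<close> and \<open>\<nu>'\<close> is a prefix
  of \<open>\<nu>\<close>: the letter \<open>N\<close> excludes that \<open>\<mu> N\<close> is a prefix of \<open>\<mu>'\<close>, and likewise for \<open>\<nu>'\<close>. By the
  hypothesis on lengths, the only surviving pair is \<open>(\<mu>, \<nu>)\<close> itself.
\<close>

lemma t_extract_coefficient:
  assumes a: "a \<in> carrier A" and N: "N \<notin> set (fst p)" "N \<notin> set (snd p)"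
    and len: "length \<mu> + length \<nu> \<le> length (fst p) + length (snd p)"
  shows "t a (map X (rev (\<mu> @ [N])) @ normal_word p @ map Y (\<nu> @ [N])) =
    (if p = (\<mu>, \<nu>) then t a [] else \<zero>)"
proof (cases "prefix (fst p) \<mu> \<and> prefix (snd p) \<nu>")
  case True
  then have "length (fst p) \<le> length \<mu>" "length (snd p) \<le> length \<nu>"
    by (auto dest: prefix_length_le)
  with len have "length (fst p) = length \<mu>" "length (snd p) = length \<nu>"
    by linarith+
  with True have p: "p = (\<mu>, \<nu>)"
    by (auto simp: prod_eq_iff prefix_def)
  have "t a (map X (rev (\<mu> @ [N])) @ normal_word p @ map Y (\<nu> @ [N])) =
      t a ([X N] @ map X (rev \<mu>) @ map Y \<mu> @ (map X (rev \<nu>) @ map Y \<nu> @ [Y N]))"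
    by (simp add: p)
  also have "\<dots> = t a ([X N] @ map X (rev \<nu>) @ map Y \<nu> @ [Y N])"
    by (rule t_cancel[OF a])
  also have "\<dots> = t a ([X N] @ [Y N])"
    by (rule t_cancel[OF a])
  also have "\<dots> = t a []"
    using t_XY[OF a, of "[]" N N "[]"] by simp
  finally show ?thesis by (simp add: p)
next
  case False
  have "\<not> prefix (\<mu> @ [N]) (fst p)" "\<not> prefix (\<nu> @ [N]) (snd p)"
    using N by (auto simp: prefix_def)
  moreover have "fst p \<noteq> \<mu> @ [N]" "snd p \<noteq> \<nu> @ [N]"
    using N by auto
  ultimately consider "\<not> prefix (fst p) (\<mu> @ [N])" "\<not> prefix (\<mu> @ [N]) (fst p)"
    | "\<not> prefix (snd p) (\<nu> @ [N])" "\<not> prefix (\<nu> @ [N]) (snd p)"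
    using False by (auto simp: prefix_snoc)
  then have "t a (map X (rev (\<mu> @ [N])) @ normal_word p @ map Y (\<nu> @ [N])) = \<zero>"
  proof cases
    case 1
    then show ?thesis
      using t_incomparable[OF a, of "\<mu> @ [N]" "fst p" "[]"] by simp
  next
    case 2
    then show ?thesis
      using t_incomparable[OF a, of "snd p" "\<nu> @ [N]" "map X (rev (\<mu> @ [N])) @ map Y (fst p)" "[]"]
      by simp
  qed
  then show ?thesis using False by auto
qed

lemma quotient_leavitt_span:
  assumes "two_sided_ideal T R"
  shows "leavitt_span A (R Quot T) (\<lambda>a w. T +> t a w)"
proof -
  interpret T: nonunital_ideal T R
    using assms by (intro nonunital_ideal.intro nonunital_ring_axioms)
  show ?thesis
  proof (intro leavitt_span.intro leavitt_span_axioms.intro A.s_unital_ring_axioms T.quotient_nonunital_ring)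
    fix x P assume x: "x \<in> carrier (R Quot T)"
      and t: "\<And>a w. a \<in> carrier A \<Longrightarrow> P (T +> t a w)"
      and add: "\<And>x y. x \<in> carrier (R Quot T) \<Longrightarrow> y \<in> carrier (R Quot T) \<Longrightarrow> P x \<Longrightarrow> P y
        \<Longrightarrow> P (x \<oplus>\<^bsub>R Quot T\<^esub> y)"
    from x obtain y where y: "y \<in> carrier R" "x = T +> y"
      by (auto simp: T.quotient_carrier)
    have "P (T +> y)"
      using y(1)
    proof (rule t_induct)
      fix x y assume "x \<in> carrier R" "y \<in> carrier R" "P (T +> x)" "P (T +> y)"
      then show "P (T +> (x \<oplus> y))"
        using add[of "T +> x" "T +> y"] by (simp add: T.quotient_simps)
    qed (rule t)
    then show "P x" by (simp add: y)
  qed (auto simp: T.quotient_simps t_closed t_add t_mult t_XY T.coset_zero)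
qed


lemma kernel_ideal: "two_sided_ideal {c \<in> carrier A. t c [] = \<zero>} A"
proof -
  have "subgroup {c \<in> carrier A. t c [] = \<zero>} (add_monoid A)"
  proof (rule A.add.subgroupI)
    show "{c \<in> carrier A. t c [] = \<zero>} \<noteq> {}"
      using t_zero A.zero_closed by blast
    fix a assume a: "a \<in> {c \<in> carrier A. t c [] = \<zero>}"
    then have "t (\<ominus>\<^bsub>A\<^esub> a) [] = t (\<ominus>\<^bsub>A\<^esub> a \<oplus>\<^bsub>A\<^esub> a) []"
      by (simp add: t_add t_closed)
    then show "\<ominus>\<^bsub>A\<^esub> a \<in> {c \<in> carrier A. t c [] = \<zero>}"
      using a by (simp add: A.l_neg t_zero)
  qed (auto simp: t_add)
  moreover have "t (a \<otimes>\<^bsub>A\<^esub> b) [] = t a [] \<otimes> t b []" if "a \<in> carrier A" "b \<in> carrier A" for a b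
    using t_mult[OF that, of "[]" "[]"] by simp
  ultimately show ?thesis
    by (intro two_sided_ideal.intro additive_subgroup.intro two_sided_ideal_axioms.intro)
       (auto simp: A.mult_closed t_closed)
qed

text \<open>
  Apply the preceding lemma to a pair of least total length among those with nonzero coefficient
  in a normal form of \<open>r\<close>, and to an index \<open>N\<close> that does not occur in that normal form.
\<close>

lemma extract_coefficient:
  assumes r: "r \<in> carrier R" "r \<noteq> \<zero>"
  obtains a x y where "a \<in> carrier A" "t a [] \<noteq> \<zero>"
    "x \<in> carrier R" "y \<in> carrier R" "x \<otimes> r \<otimes> y = t a []"
proof -
  obtain F c where F: "finite F" and c: "\<And>p. c p \<in> carrier A"
    and r_eq: "r = (\<Oplus>p\<in>F. t (c p) (normal_word p))"
    using finite_normal_form r by blast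
  define S where "S = {p \<in> F. t (c p) [] \<noteq> \<zero>}"
  have zero: "t (c p) w = \<zero>" if "p \<in> F - S" for p w
    using t_eq_zero[OF c, of p] that by (simp add: S_def)
  have "S \<noteq> {}"
    using r(2) zero add.finprod_one_eqI[of F "\<lambda>p. t (c p) (normal_word p)"] r_eq by blast
  then obtain p0 where p0: "p0 \<in> S"
    and min: "\<And>p. p \<in> S \<Longrightarrow> length (fst p0) + length (snd p0) \<le> length (fst p) + length (snd p)"
    using ex_has_least_nat[of "\<lambda>p. p \<in> S" _ "\<lambda>p. length (fst p) + length (snd p)"] by blast
  have "finite (\<Union>p\<in>F. set (fst p) \<union> set (snd p))"
    using F by auto
  then obtain N where N: "N \<notin> (\<Union>p\<in>F. set (fst p) \<union> set (snd p))"
    using ex_new_if_finite infinite_UNIV_nat by blast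
  obtain u v where uv: "u \<in> carrier A" "v \<in> carrier A"
    "u \<otimes>\<^bsub>A\<^esub> c p0 = c p0" "c p0 \<otimes>\<^bsub>A\<^esub> v = c p0"
    using A.s_unital[OF c] by blast
  define x y where "x = t u (map X (rev (fst p0 @ [N])))" and "y = t v (map Y (snd p0 @ [N]))"
  have xy: "x \<in> carrier R" "y \<in> carrier R"
    using uv by (simp_all add: x_def y_def t_closed)
  have "x \<otimes> r \<otimes> y = (\<Oplus>p\<in>F. x \<otimes> t (c p) (normal_word p) \<otimes> y)"
    unfolding r_eq by (rule finsum_mult_both[OF F]) (simp_all add: t_closed c xy)
  also have "\<dots> = (\<Oplus>p\<in>F. if p0 = p then t (c p) [] else \<zero>)"
  proof (rule finsum_cong')
    fix p assume p: "p \<in> F"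
    show "x \<otimes> t (c p) (normal_word p) \<otimes> y = (if p0 = p then t (c p) [] else \<zero>)"
    proof (cases "p \<in> S")
      case False
      then show ?thesis
        using zero[of p] p p0 xy by auto
    next
      case True
      let ?a = "u \<otimes>\<^bsub>A\<^esub> c p \<otimes>\<^bsub>A\<^esub> v"
      have "x \<otimes> t (c p) (normal_word p) \<otimes> y =
          t ?a (map X (rev (fst p0 @ [N])) @ normal_word p @ map Y (snd p0 @ [N]))"
        using uv c by (simp add: x_def y_def t_mult A.mult_closed)
      also have "\<dots> = (if p = (fst p0, snd p0) then t ?a [] else \<zero>)"
        by (rule t_extract_coefficient) (use uv c N p min[OF True] in \<open>auto simp: A.mult_closed\<close>)
      finally show ?thesis
        using uv by auto
    qed
  qed (auto simp: t_closed c)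
  also have "\<dots> = t (c p0) []"
    by (rule finsum_singleton) (use p0 F c in \<open>auto simp: S_def t_closed\<close>)
  finally show thesis
    using that[of "c p0" x y] c xy p0 by (simp add: S_def)
qed

text \<open>
  The relations \<open>x\<^sub>i y\<^sub>j = \<delta>\<^sub>i\<^sub>j\<close> for two indices, multiplied by local units of \<open>e\<close>.
\<close>

lemma t_properly_infinite:
  assumes e: "e \<in> carrier A"
  obtains a1 a2 b1 b2 where "a1 \<in> carrier R" "a2 \<in> carrier R" "b1 \<in> carrier R" "b2 \<in> carrier R"
    "a1 \<otimes> t e [] \<otimes> b1 = t e []" "a1 \<otimes> t e [] \<otimes> b2 = \<zero>"
    "a2 \<otimes> t e [] \<otimes> b1 = \<zero>" "a2 \<otimes> t e [] \<otimes> b2 = t e []"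
proof -
  obtain u v where uv: "u \<in> carrier A" "v \<in> carrier A" "u \<otimes>\<^bsub>A\<^esub> e = e" "e \<otimes>\<^bsub>A\<^esub> v = e"
    using A.s_unital[OF e] by blast
  have "t u [X i] \<otimes> t e [] \<otimes> t v [Y j] = (if i = j then t e [] else \<zero>)" for i j
    using uv e t_XY[OF e, of "[]" i j "[]"] by (simp add: t_mult)
  then show thesis
    using that[of "t u [X 0]" "t u [X 1]" "t v [Y 0]" "t v [Y 1]"] uv by (simp add: t_closed)
qed

end

section \<open>Absorption when right ideals contain idempotents\<close>

locale leavitt_span_idempotents = leavitt_span +
  assumes idempotents: "\<And>I J. two_sided_ideal I A \<Longrightarrow> right_ideal J (A Quot I) \<Longrightarrow> J \<noteq> {\<zero>\<^bsub>A Quot I\<^esub>} \<Longrightarrow>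
      \<exists>e\<in>J. e \<noteq> \<zero>\<^bsub>A Quot I\<^esub> \<and> is_idempotent (A Quot I) e"
begin

text \<open>
  The hypothesis is applied to the right ideal generated by \<open>a\<close> in the quotient of \<open>A\<close> by the kernel
  of \<open>c \<mapsto> c \<otimes> 1\<close>. The idempotent found there is the class of a multiple \<open>ab\<close>, and it becomes an
  honest idempotent \<open>ab \<otimes> 1\<close> in \<open>R\<close>.
\<close>

lemma idempotent_multiple:
  assumes a: "a \<in> carrier A" "t a [] \<noteq> \<zero>"
  obtains b where "b \<in> carrier A" "t (a \<otimes>\<^bsub>A\<^esub> b) [] \<noteq> \<zero>"
    "t (a \<otimes>\<^bsub>A\<^esub> b) [] \<otimes> t (a \<otimes>\<^bsub>A\<^esub> b) [] = t (a \<otimes>\<^bsub>A\<^esub> b) []"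
proof -
  define J where "J = {c \<in> carrier A. t c [] = \<zero>}"
  have J_iff: "x \<in> J \<longleftrightarrow> x \<in> carrier A \<and> t x [] = \<zero>" for x
    unfolding J_def by blast
  interpret J: nonunital_ideal J A
    using kernel_ideal by (intro nonunital_ideal.intro A.nonunital_ring_axioms) (simp add: J_def)
  interpret Q: nonunital_ring "A Quot J" by (rule J.quotient_nonunital_ring)
  let ?q = "\<lambda>b. J +>\<^bsub>A\<^esub> (a \<otimes>\<^bsub>A\<^esub> b)"
  let ?P = "?q ` carrier A"
  have "subgroup ?P (add_monoid (A Quot J))"
  proof (rule Q.add.subgroupI)
    show "?P \<subseteq> carrier (A Quot J)"
      using a by (auto simp: J.quotient_carrier A.mult_closed)
    show "?P \<noteq> {}"
      using A.zero_closed by blast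
    fix x y assume "x \<in> ?P" "y \<in> ?P"
    then obtain b c where bc: "b \<in> carrier A" "c \<in> carrier A" "x = ?q b" "y = ?q c"
      by auto
    then have "\<ominus>\<^bsub>A Quot J\<^esub> x = ?q (\<ominus>\<^bsub>A\<^esub> b)" "x \<oplus>\<^bsub>A Quot J\<^esub> y = ?q (b \<oplus>\<^bsub>A\<^esub> c)"
      using a by (simp_all add: J.quotient_minus J.quotient_add A.mult_closed A.mult_minus A.mult_r_distr)
    then show "\<ominus>\<^bsub>A Quot J\<^esub> x \<in> ?P" "x \<oplus>\<^bsub>A Quot J\<^esub> y \<in> ?P"
      using bc by auto
  qed
  moreover have "?q b \<otimes>\<^bsub>A Quot J\<^esub> (J +>\<^bsub>A\<^esub> c) \<in> ?P" if "b \<in> carrier A" "c \<in> carrier A" for b c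
    using a that by (auto simp: J.quotient_mult A.mult_closed A.mult_assoc)
  ultimately have right: "right_ideal ?P (A Quot J)"
    by (intro right_ideal.intro additive_subgroup.intro right_ideal_axioms.intro)
       (auto simp: J.quotient_carrier)
  have nonzero: "?P \<noteq> {\<zero>\<^bsub>A Quot J\<^esub>}"
  proof -
    obtain v where "v \<in> carrier A" "a \<otimes>\<^bsub>A\<^esub> v = a"
      using A.s_unital a by blast
    then have "J +>\<^bsub>A\<^esub> a \<in> ?P" by force
    moreover have "J +>\<^bsub>A\<^esub> a \<noteq> \<zero>\<^bsub>A Quot J\<^esub>"
      using a by (simp add: J.quotient_zero J.coset_eq_zero_iff J_iff)
    ultimately show ?thesis by (metis singletonD)
  qed
  obtain z where "z \<in> ?P" and z: "z \<noteq> \<zero>\<^bsub>A Quot J\<^esub>" "is_idempotent (A Quot J) z"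
    using idempotents[OF J.two_sided_ideal_axioms right nonzero] by (rule bexE) (elim conjE, rule that)
  from this(1) obtain b where b: "b \<in> carrier A" and zb: "z = ?q b"
    by (rule imageE) (rule that)
  note ne = z(1)[unfolded zb] and idem = z(2)[unfolded zb]
  define e where "e = a \<otimes>\<^bsub>A\<^esub> b"
  have e: "e \<in> carrier A" "e \<otimes>\<^bsub>A\<^esub> e \<in> carrier A"
    using a b by (simp_all add: e_def A.mult_closed)
  have "e \<otimes>\<^bsub>A\<^esub> e \<ominus>\<^bsub>A\<^esub> e \<in> J"
    using idem e J.coset_eq_iff[of "e \<otimes>\<^bsub>A\<^esub> e" e]
    by (simp add: is_idempotent_def J.quotient_mult flip: e_def)
  then have "t (e \<otimes>\<^bsub>A\<^esub> e \<ominus>\<^bsub>A\<^esub> e \<oplus>\<^bsub>A\<^esub> e) [] = t e []"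
    unfolding J_iff using e by (simp add: t_add t_closed)
  then have "t e [] \<otimes> t e [] = t e []"
    using e by (simp add: t_mult A.minus_eq A.a_assoc A.l_neg)
  moreover have "t e [] \<noteq> \<zero>"
    using ne e by (simp add: J.quotient_zero J.coset_eq_zero_iff J_iff flip: e_def)
  ultimately show thesis
    using that b unfolding e_def by blast
qed

lemma zero_if_absorbs_only_zero:
  assumes r: "r \<in> carrier R" and abs: "absorbed R r \<subseteq> {\<zero>}"
  shows "r = \<zero>"
proof (rule ccontr)
  assume "r \<noteq> \<zero>"
  then obtain a x y where a: "a \<in> carrier A" "t a [] \<noteq> \<zero>"
    and xy: "x \<in> carrier R" "y \<in> carrier R" "x \<otimes> r \<otimes> y = t a []"
    using extract_coefficient r by blast
  obtain b where b: "b \<in> carrier A" and ne: "t (a \<otimes>\<^bsub>A\<^esub> b) [] \<noteq> \<zero>"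
    and idem: "t (a \<otimes>\<^bsub>A\<^esub> b) [] \<otimes> t (a \<otimes>\<^bsub>A\<^esub> b) [] = t (a \<otimes>\<^bsub>A\<^esub> b) []"
    using idempotent_multiple a by blast
  define E where "E = t (a \<otimes>\<^bsub>A\<^esub> b) []"
  have ab: "a \<otimes>\<^bsub>A\<^esub> b \<in> carrier A" using a b by (simp add: A.mult_closed)
  have "x \<otimes> r \<otimes> (y \<otimes> t b []) = x \<otimes> r \<otimes> y \<otimes> t b []"
    using xy(1,2) b r by (simp add: t_closed mult_closed mult_assoc)
  then have xry: "x \<otimes> r \<otimes> (y \<otimes> t b []) = E"
    using a b by (simp add: xy(3) t_mult E_def)
  have E: "E \<in> carrier R" "y \<otimes> t b [] \<in> carrier R"
    using ab b xy(2) by (simp_all add: E_def t_closed mult_closed)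
  obtain u v where uv: "u \<in> carrier R" "v \<in> carrier R" "u \<otimes> r = r" "r \<otimes> v = r"
    using local_units r by blast
  obtain a1 a2 b1 b2 where inf: "a1 \<in> carrier R" "a2 \<in> carrier R" "b1 \<in> carrier R" "b2 \<in> carrier R"
    "a1 \<otimes> E \<otimes> b1 = E" "a1 \<otimes> E \<otimes> b2 = \<zero>" "a2 \<otimes> E \<otimes> b1 = \<zero>" "a2 \<otimes> E \<otimes> b2 = E"
    using t_properly_infinite[OF ab] unfolding E_def by blast
  have "E \<in> absorbed R r"
    by (rule idempotent_absorbed[OF r E(1) xy(1) E(2) inf(1-4) uv(1,2) idem[folded E_def] xry uv(3,4) inf(5-8)])
  then show False using abs ne by (auto simp: E_def)
qed

text \<open>
  If \<open>T\<close> is the ideal of the elements absorbed by \<open>r\<close>, then \<open>R/T\<close> is again a span over the same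
  \<open>A\<close>, and the class of \<open>r\<close> absorbs only \<open>0\<close> there. So this class is \<open>0\<close>.
\<close>

lemma absorbs_itself:
  assumes r: "r \<in> carrier R"
  shows "r \<in> absorbed R r"
proof -
  let ?T = "absorbed R r"
  obtain u v where "u \<in> carrier R" "v \<in> carrier R" "u \<otimes> r = r" "r \<otimes> v = r"
    using local_units r by blast
  then have ideal: "two_sided_ideal ?T R"
    using absorbed_ideal r by blast
  interpret T: nonunital_ideal ?T R
    using ideal by (intro nonunital_ideal.intro nonunital_ring_axioms)
  interpret Q: leavitt_span A "R Quot ?T" "\<lambda>a w. ?T +> t a w"
    by (rule quotient_leavitt_span[OF ideal])
  interpret Q: leavitt_span_idempotents A "R Quot ?T" "\<lambda>a w. ?T +> t a w"
    by unfold_locales (rule idempotents)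
  have "x = \<zero>\<^bsub>R Quot ?T\<^esub>" if x: "x \<in> absorbed (R Quot ?T) (?T +> r)" for x
  proof -
    obtain s where s: "s \<in> carrier R" "x = ?T +> s"
      using x unfolding absorbed_def[of "R Quot ?T"] by (auto simp: T.quotient_carrier)
    then have "s \<in> ?T"
      using absorbed_quotient r ideal x by blast
    then show ?thesis
      using s by (simp add: T.quotient_zero T.coset_eq_zero_iff)
  qed
  then have "?T +> r = \<zero>\<^bsub>R Quot ?T\<^esub>"
    using r by (intro Q.zero_if_absorbs_only_zero) (auto simp: T.quotient_carrier)
  then show ?thesis
    using r by (simp add: T.quotient_zero T.coset_eq_zero_iff)
qed

lemma properly_purely_infinite: "properly_purely_infinite_ring R"
  by (intro properly_purely_infinite_ring.intro properly_purely_infinite_ring_axioms.intro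
      nonunital_ring_axioms) (simp add: properly_infinite_iff_absorbed absorbs_itself)

end

section \<open>Semigroup algebras\<close>

locale semigroup_over_cring = cring K for K (structure) and S :: "('s, 'n) monoid_scheme" +
  assumes S_closed: "s \<in> carrier S \<Longrightarrow> t \<in> carrier S \<Longrightarrow> s \<otimes>\<^bsub>S\<^esub> t \<in> carrier S"
    and S_assoc: "s \<in> carrier S \<Longrightarrow> t \<in> carrier S \<Longrightarrow> u \<in> carrier S \<Longrightarrow>
      (s \<otimes>\<^bsub>S\<^esub> t) \<otimes>\<^bsub>S\<^esub> u = s \<otimes>\<^bsub>S\<^esub> (t \<otimes>\<^bsub>S\<^esub> u)"
begin

abbreviation KS where "KS \<equiv> semigroup_algebra K S"

definition supp :: "('s \<Rightarrow> 'a) \<Rightarrow> 's set"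
  where "supp f = {s. f s \<noteq> \<zero>}"

lemma KS_simps:
  shows "\<zero>\<^bsub>KS\<^esub> = (\<lambda>s. \<zero>)" "f \<oplus>\<^bsub>KS\<^esub> g = (\<lambda>s. f s \<oplus> g s)" "c \<odot>\<^bsub>KS\<^esub> f = (\<lambda>s. c \<otimes> f s)"
    "\<one>\<^bsub>KS\<^esub> = basis_elem K \<one>\<^bsub>S\<^esub>"
  by (simp_all add: semigroup_algebra_def)

lemma KS_carrier: "f \<in> carrier KS \<longleftrightarrow> (\<forall>s. f s \<in> carrier K) \<and> supp f \<subseteq> carrier S \<and> finite (supp f)"
  by (auto simp: semigroup_algebra_def supp_def)

lemma KS_value: "f \<in> carrier KS \<Longrightarrow> f s \<in> carrier K"
  by (simp add: KS_carrier)

text \<open>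
  Replacing the supports by larger finite sets lets two convolutions be summed over the same index
  set, as distributivity requires.
\<close>

lemma KS_mult:
  assumes f: "f \<in> carrier KS" and g: "g \<in> carrier KS"
    and U: "finite U" "supp f \<subseteq> U" and V: "finite V" "supp g \<subseteq> V"
  shows "(f \<otimes>\<^bsub>KS\<^esub> g) s = (\<Oplus>p\<in>{p \<in> U \<times> V. fst p \<otimes>\<^bsub>S\<^esub> snd p = s}. f (fst p) \<otimes> g (snd p))"
proof -
  have "(f \<otimes>\<^bsub>KS\<^esub> g) s =
      (\<Oplus>p\<in>{(u, v). f u \<noteq> \<zero> \<and> g v \<noteq> \<zero> \<and> u \<otimes>\<^bsub>S\<^esub> v = s}. f (fst p) \<otimes> g (snd p))"
    by (simp add: semigroup_algebra_def)
  also have "\<dots> = (\<Oplus>p\<in>{p \<in> U \<times> V. fst p \<otimes>\<^bsub>S\<^esub> snd p = s}. f (fst p) \<otimes> g (snd p))"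
    by (rule add.finprod_mono_neutral_cong_left)
       (use U V KS_value[OF f] KS_value[OF g] in \<open>auto simp: supp_def\<close>)
  finally show ?thesis .
qed

lemma KS_mult_closed:
  assumes f: "f \<in> carrier KS" and g: "g \<in> carrier KS"
  shows "f \<otimes>\<^bsub>KS\<^esub> g \<in> carrier KS"
proof -
  let ?I = "\<lambda>s. {p \<in> supp f \<times> supp g. fst p \<otimes>\<^bsub>S\<^esub> snd p = s}"
  have eq: "(f \<otimes>\<^bsub>KS\<^esub> g) s = (\<Oplus>p\<in>?I s. f (fst p) \<otimes> g (snd p))" for s
    using f g by (intro KS_mult) (auto simp: KS_carrier)
  have "supp (f \<otimes>\<^bsub>KS\<^esub> g) \<subseteq> (\<lambda>p. fst p \<otimes>\<^bsub>S\<^esub> snd p) ` (supp f \<times> supp g)"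
  proof
    fix s assume s: "s \<in> supp (f \<otimes>\<^bsub>KS\<^esub> g)"
    have "?I s \<noteq> {}"
    proof
      assume "?I s = {}"
      then have "(f \<otimes>\<^bsub>KS\<^esub> g) s = \<zero>" unfolding eq by (simp only: finsum_empty)
      with s show False by (simp add: supp_def)
    qed
    then show "s \<in> (\<lambda>p. fst p \<otimes>\<^bsub>S\<^esub> snd p) ` (supp f \<times> supp g)"
      by blast
  qed
  moreover have "(\<lambda>p. fst p \<otimes>\<^bsub>S\<^esub> snd p) ` (supp f \<times> supp g) \<subseteq> carrier S"
    using f g S_closed by (auto simp: KS_carrier subset_iff)
  moreover have "finite ((\<lambda>p. fst p \<otimes>\<^bsub>S\<^esub> snd p) ` (supp f \<times> supp g))"
    using f g by (simp add: KS_carrier)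
  moreover have "(f \<otimes>\<^bsub>KS\<^esub> g) s \<in> carrier K" for s
    unfolding eq using KS_value[OF f] KS_value[OF g] by (intro finsum_closed) auto
  ultimately show ?thesis
    unfolding KS_carrier by (meson finite_subset subset_trans)
qed

lemma basis_elem_closed: "s \<in> carrier S \<Longrightarrow> basis_elem K s \<in> carrier KS"
  by (auto simp: KS_carrier supp_def basis_elem_def intro: finite_subset[of _ "{s}"])

lemma basis_elem_mult:
  assumes "s \<in> carrier S" "t \<in> carrier S"
  shows "basis_elem K s \<otimes>\<^bsub>KS\<^esub> basis_elem K t = basis_elem K (s \<otimes>\<^bsub>S\<^esub> t)"
proof
  fix z
  have "(basis_elem K s \<otimes>\<^bsub>KS\<^esub> basis_elem K t) z =
      (\<Oplus>p\<in>{p \<in> {s} \<times> {t}. fst p \<otimes>\<^bsub>S\<^esub> snd p = z}. basis_elem K s (fst p) \<otimes> basis_elem K t (snd p))"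
    by (intro KS_mult basis_elem_closed assms) (auto simp: supp_def basis_elem_def)
  also have "{p \<in> {s} \<times> {t}. fst p \<otimes>\<^bsub>S\<^esub> snd p = z} = (if s \<otimes>\<^bsub>S\<^esub> t = z then {(s, t)} else {})"
    by auto
  finally show "(basis_elem K s \<otimes>\<^bsub>KS\<^esub> basis_elem K t) z = basis_elem K (s \<otimes>\<^bsub>S\<^esub> t) z"
    by (auto simp: basis_elem_def)
qed

lemma KS_add_closed:
  assumes "f \<in> carrier KS" "g \<in> carrier KS"
  shows "f \<oplus>\<^bsub>KS\<^esub> g \<in> carrier KS"
proof -
  have "supp (f \<oplus>\<^bsub>KS\<^esub> g) \<subseteq> supp f \<union> supp g"
    by (auto simp: supp_def KS_simps)
  moreover have "(f \<oplus>\<^bsub>KS\<^esub> g) s \<in> carrier K" for s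
    using assms by (simp add: KS_carrier KS_simps)
  ultimately show ?thesis
    using assms unfolding KS_carrier by (meson finite_Un finite_subset le_sup_iff subset_trans)
qed

lemma KS_smult_closed:
  assumes c: "c \<in> carrier K" and f: "f \<in> carrier KS"
  shows "c \<odot>\<^bsub>KS\<^esub> f \<in> carrier KS"
proof -
  have "supp (c \<odot>\<^bsub>KS\<^esub> f) \<subseteq> supp f"
    using c by (auto simp: supp_def KS_simps)
  moreover have "(c \<odot>\<^bsub>KS\<^esub> f) s \<in> carrier K" for s
    using assms by (simp add: KS_carrier KS_simps)
  ultimately show ?thesis
    using f unfolding KS_carrier by (meson finite_subset subset_trans)
qed

lemma KS_abelian_group: "abelian_group KS"
proof (rule abelian_groupI)
  show "\<zero>\<^bsub>KS\<^esub> \<in> carrier KS"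
    by (simp add: KS_carrier KS_simps supp_def)
  fix f assume f: "f \<in> carrier KS"
  have "supp (\<lambda>s. \<ominus> f s) = supp f"
    using KS_value[OF f] by (auto simp: supp_def)
  then have "(\<lambda>s. \<ominus> f s) \<in> carrier KS"
    using f by (simp add: KS_carrier)
  moreover have "(\<lambda>s. \<ominus> f s) \<oplus>\<^bsub>KS\<^esub> f = \<zero>\<^bsub>KS\<^esub>"
    using KS_value[OF f] by (simp add: KS_simps l_neg)
  ultimately show "\<exists>g\<in>carrier KS. g \<oplus>\<^bsub>KS\<^esub> f = \<zero>\<^bsub>KS\<^esub>" by blast
qed (simp_all add: KS_add_closed, auto simp: KS_simps KS_value a_ac)

lemma KS_mult_l_distr:
  assumes "f \<in> carrier KS" "g \<in> carrier KS" "h \<in> carrier KS"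
  shows "(f \<oplus>\<^bsub>KS\<^esub> g) \<otimes>\<^bsub>KS\<^esub> h = f \<otimes>\<^bsub>KS\<^esub> h \<oplus>\<^bsub>KS\<^esub> g \<otimes>\<^bsub>KS\<^esub> h"
proof
  fix s
  let ?I = "{p \<in> (supp f \<union> supp g) \<times> supp h. fst p \<otimes>\<^bsub>S\<^esub> snd p = s}"
  have fin: "finite (supp f \<union> supp g)" "finite (supp h)"
    using assms by (auto simp: KS_carrier)
  have "supp (f \<oplus>\<^bsub>KS\<^esub> g) \<subseteq> supp f \<union> supp g"
    by (auto simp: supp_def KS_simps)
  then have "((f \<oplus>\<^bsub>KS\<^esub> g) \<otimes>\<^bsub>KS\<^esub> h) s = (\<Oplus>p\<in>?I. (f \<oplus>\<^bsub>KS\<^esub> g) (fst p) \<otimes> h (snd p))"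
    by (intro KS_mult KS_add_closed assms fin) auto
  also have "\<dots> = (\<Oplus>p\<in>?I. f (fst p) \<otimes> h (snd p) \<oplus> g (fst p) \<otimes> h (snd p))"
    using assms by (intro finsum_cong') (auto simp: KS_simps KS_value l_distr)
  also have "\<dots> = (\<Oplus>p\<in>?I. f (fst p) \<otimes> h (snd p)) \<oplus> (\<Oplus>p\<in>?I. g (fst p) \<otimes> h (snd p))"
    using assms by (intro finsum_addf) (auto simp: KS_value)
  also have "(\<Oplus>p\<in>?I. f (fst p) \<otimes> h (snd p)) = (f \<otimes>\<^bsub>KS\<^esub> h) s"
    by (intro KS_mult[symmetric] assms fin) auto
  also have "(\<Oplus>p\<in>?I. g (fst p) \<otimes> h (snd p)) = (g \<otimes>\<^bsub>KS\<^esub> h) s"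
    by (intro KS_mult[symmetric] assms fin) auto
  finally show "((f \<oplus>\<^bsub>KS\<^esub> g) \<otimes>\<^bsub>KS\<^esub> h) s = (f \<otimes>\<^bsub>KS\<^esub> h \<oplus>\<^bsub>KS\<^esub> g \<otimes>\<^bsub>KS\<^esub> h) s"
    by (simp add: KS_simps)
qed

lemma KS_mult_r_distr:
  assumes "f \<in> carrier KS" "g \<in> carrier KS" "h \<in> carrier KS"
  shows "h \<otimes>\<^bsub>KS\<^esub> (f \<oplus>\<^bsub>KS\<^esub> g) = h \<otimes>\<^bsub>KS\<^esub> f \<oplus>\<^bsub>KS\<^esub> h \<otimes>\<^bsub>KS\<^esub> g"
proof
  fix s
  let ?I = "{p \<in> supp h \<times> (supp f \<union> supp g). fst p \<otimes>\<^bsub>S\<^esub> snd p = s}"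
  have fin: "finite (supp f \<union> supp g)" "finite (supp h)"
    using assms by (auto simp: KS_carrier)
  have "supp (f \<oplus>\<^bsub>KS\<^esub> g) \<subseteq> supp f \<union> supp g"
    by (auto simp: supp_def KS_simps)
  then have "(h \<otimes>\<^bsub>KS\<^esub> (f \<oplus>\<^bsub>KS\<^esub> g)) s = (\<Oplus>p\<in>?I. h (fst p) \<otimes> (f \<oplus>\<^bsub>KS\<^esub> g) (snd p))"
    by (intro KS_mult KS_add_closed assms fin) auto
  also have "\<dots> = (\<Oplus>p\<in>?I. h (fst p) \<otimes> f (snd p) \<oplus> h (fst p) \<otimes> g (snd p))"
    using assms by (intro finsum_cong') (auto simp: KS_simps KS_value r_distr)
  also have "\<dots> = (\<Oplus>p\<in>?I. h (fst p) \<otimes> f (snd p)) \<oplus> (\<Oplus>p\<in>?I. h (fst p) \<otimes> g (snd p))"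
    using assms by (intro finsum_addf) (auto simp: KS_value)
  also have "(\<Oplus>p\<in>?I. h (fst p) \<otimes> f (snd p)) = (h \<otimes>\<^bsub>KS\<^esub> f) s"
    by (intro KS_mult[symmetric] assms fin) auto
  also have "(\<Oplus>p\<in>?I. h (fst p) \<otimes> g (snd p)) = (h \<otimes>\<^bsub>KS\<^esub> g) s"
    by (intro KS_mult[symmetric] assms fin) auto
  finally show "(h \<otimes>\<^bsub>KS\<^esub> (f \<oplus>\<^bsub>KS\<^esub> g)) s = (h \<otimes>\<^bsub>KS\<^esub> f \<oplus>\<^bsub>KS\<^esub> h \<otimes>\<^bsub>KS\<^esub> g) s"
    by (simp add: KS_simps)
qed

lemma KS_smult_mult:
  assumes c: "c \<in> carrier K" and f: "f \<in> carrier KS" and g: "g \<in> carrier KS"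
  shows "(c \<odot>\<^bsub>KS\<^esub> f) \<otimes>\<^bsub>KS\<^esub> g = c \<odot>\<^bsub>KS\<^esub> (f \<otimes>\<^bsub>KS\<^esub> g)"
    and "f \<otimes>\<^bsub>KS\<^esub> (c \<odot>\<^bsub>KS\<^esub> g) = c \<odot>\<^bsub>KS\<^esub> (f \<otimes>\<^bsub>KS\<^esub> g)"
proof -
  let ?I = "\<lambda>s. {p \<in> supp f \<times> supp g. fst p \<otimes>\<^bsub>S\<^esub> snd p = s}"
  have fin: "finite (supp f)" "finite (supp g)" and fin_I: "finite (?I s)" for s
    using f g by (auto simp: KS_carrier)
  have supp: "supp (c \<odot>\<^bsub>KS\<^esub> h) \<subseteq> supp h" for h
    using c by (auto simp: supp_def KS_simps)
  have eq: "(c \<odot>\<^bsub>KS\<^esub> (f \<otimes>\<^bsub>KS\<^esub> g)) s = (\<Oplus>p\<in>?I s. c \<otimes> (f (fst p) \<otimes> g (snd p)))" for s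
    using c f g unfolding KS_simps(3) KS_mult[OF f g fin(1) order.refl fin(2) order.refl]
    by (intro finsum_rdistr fin_I) (auto simp: KS_value)
  show "(c \<odot>\<^bsub>KS\<^esub> f) \<otimes>\<^bsub>KS\<^esub> g = c \<odot>\<^bsub>KS\<^esub> (f \<otimes>\<^bsub>KS\<^esub> g)"
  proof
    fix s
    have "((c \<odot>\<^bsub>KS\<^esub> f) \<otimes>\<^bsub>KS\<^esub> g) s = (\<Oplus>p\<in>?I s. (c \<odot>\<^bsub>KS\<^esub> f) (fst p) \<otimes> g (snd p))"
      by (intro KS_mult KS_smult_closed c f g fin supp order.refl)
    also have "\<dots> = (\<Oplus>p\<in>?I s. c \<otimes> (f (fst p) \<otimes> g (snd p)))"
      using c f g by (intro finsum_cong') (auto simp: KS_simps KS_value m_assoc)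
    finally show "((c \<odot>\<^bsub>KS\<^esub> f) \<otimes>\<^bsub>KS\<^esub> g) s = (c \<odot>\<^bsub>KS\<^esub> (f \<otimes>\<^bsub>KS\<^esub> g)) s"
      by (simp add: eq)
  qed
  show "f \<otimes>\<^bsub>KS\<^esub> (c \<odot>\<^bsub>KS\<^esub> g) = c \<odot>\<^bsub>KS\<^esub> (f \<otimes>\<^bsub>KS\<^esub> g)"
  proof
    fix s
    have "(f \<otimes>\<^bsub>KS\<^esub> (c \<odot>\<^bsub>KS\<^esub> g)) s = (\<Oplus>p\<in>?I s. f (fst p) \<otimes> (c \<odot>\<^bsub>KS\<^esub> g) (snd p))"
      by (intro KS_mult KS_smult_closed c f g fin supp order.refl)
    also have "\<dots> = (\<Oplus>p\<in>?I s. c \<otimes> (f (fst p) \<otimes> g (snd p)))"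
      using c f g by (intro finsum_cong') (auto simp: KS_simps KS_value m_lcomm)
    finally show "(f \<otimes>\<^bsub>KS\<^esub> (c \<odot>\<^bsub>KS\<^esub> g)) s = (c \<odot>\<^bsub>KS\<^esub> (f \<otimes>\<^bsub>KS\<^esub> g)) s"
      by (simp add: eq)
  qed
qed

lemma KS_induct [consumes 1, case_names zero smult_basis add]:
  assumes f: "f \<in> carrier KS"
    and zero: "P \<zero>\<^bsub>KS\<^esub>"
    and basis: "\<And>c s. c \<in> carrier K \<Longrightarrow> s \<in> carrier S \<Longrightarrow> P (c \<odot>\<^bsub>KS\<^esub> basis_elem K s)"
    and add: "\<And>f g. f \<in> carrier KS \<Longrightarrow> g \<in> carrier KS \<Longrightarrow> P f \<Longrightarrow> P g \<Longrightarrow> P (f \<oplus>\<^bsub>KS\<^esub> g)"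
  shows "P f"
proof -
  have *: "\<forall>f\<in>carrier KS. supp f \<subseteq> U \<longrightarrow> P f" if "finite U" "U \<subseteq> carrier S" for U
    using that
  proof (induction U rule: finite_induct)
    case empty
    have "f = \<zero>\<^bsub>KS\<^esub>" if "supp f \<subseteq> {}" for f
      using that by (auto simp: supp_def KS_simps)
    then show ?case using zero by blast
  next
    case (insert s U)
    show ?case
    proof (intro ballI impI)
      fix f assume f: "f \<in> carrier KS" and sub: "supp f \<subseteq> insert s U"
      have s: "s \<in> carrier S" using insert by simp
      have "supp (f(s := \<zero>)) = supp f - {s}"
        by (auto simp: supp_def)
      then have g: "f(s := \<zero>) \<in> carrier KS" "supp (f(s := \<zero>)) \<subseteq> U"
        using f sub by (auto simp: KS_carrier)
      then have "P (f(s := \<zero>))" using insert by simp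
      moreover have "P (f s \<odot>\<^bsub>KS\<^esub> basis_elem K s)"
        by (rule basis[OF KS_value[OF f] s])
      moreover have "f = f(s := \<zero>) \<oplus>\<^bsub>KS\<^esub> (f s \<odot>\<^bsub>KS\<^esub> basis_elem K s)"
        using KS_value[OF f] by (auto simp: KS_simps basis_elem_def)
      ultimately show "P f"
        using add[OF g(1) KS_smult_closed[OF KS_value[OF f] basis_elem_closed[OF s]]] by metis
    qed
  qed
  have "finite (supp f)" "supp f \<subseteq> carrier S"
    using f by (simp_all add: KS_carrier)
  from *[OF this] f show ?thesis by blast
qed

lemma KS_module: "module K KS"
proof (rule moduleI[OF is_cring KS_abelian_group])
  fix c f assume "c \<in> carrier K" "f \<in> carrier KS"
  then show "c \<odot>\<^bsub>KS\<^esub> f \<in> carrier KS" by (rule KS_smult_closed)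
qed (simp_all add: KS_simps KS_value l_distr r_distr m_assoc)

interpretation KS: module K KS by (rule KS_module)

lemma KS_mult_zero:
  assumes "f \<in> carrier KS"
  shows "\<zero>\<^bsub>KS\<^esub> \<otimes>\<^bsub>KS\<^esub> f = \<zero>\<^bsub>KS\<^esub>" "f \<otimes>\<^bsub>KS\<^esub> \<zero>\<^bsub>KS\<^esub> = \<zero>\<^bsub>KS\<^esub>"
  using KS_smult_mult(1)[of \<zero> "\<zero>\<^bsub>KS\<^esub>" f] KS_smult_mult(2)[of \<zero> f "\<zero>\<^bsub>KS\<^esub>"] assms
  by (simp_all add: KS_mult_closed)

text \<open>
  All three arguments are reduced to basis elements by linearity, which avoids reindexing double
  sums.
\<close>

lemma KS_mult_assoc:
  assumes "f \<in> carrier KS" "g \<in> carrier KS" "h \<in> carrier KS"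
  shows "(f \<otimes>\<^bsub>KS\<^esub> g) \<otimes>\<^bsub>KS\<^esub> h = f \<otimes>\<^bsub>KS\<^esub> (g \<otimes>\<^bsub>KS\<^esub> h)"
  using assms
proof (induction f rule: KS_induct)
  case (smult_basis c s)
  from smult_basis(3,4) show ?case
  proof (induction g rule: KS_induct)
    case (smult_basis c' t)
    from smult_basis(3) show ?case
    proof (induction h rule: KS_induct)
      case (smult_basis c'' u)
      then show ?case
        using \<open>c \<in> carrier K\<close> \<open>s \<in> carrier S\<close> \<open>c' \<in> carrier K\<close> \<open>t \<in> carrier S\<close>
        by (simp add: KS_smult_mult basis_elem_mult basis_elem_closed S_closed S_assoc)
    qed (use smult_basis \<open>c \<in> carrier K\<close> \<open>s \<in> carrier S\<close> in \<open>simp_all add: KS_mult_zero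
        KS_mult_r_distr KS_mult_closed basis_elem_closed\<close>)
  qed (use smult_basis in \<open>simp_all add: KS_mult_zero KS_mult_l_distr KS_mult_r_distr
        KS_mult_closed basis_elem_closed\<close>)
qed (simp_all add: KS_mult_zero KS_mult_l_distr KS_mult_closed)

lemma KS_nonunital_algebra: "nonunital_algebra K KS"
  by (intro nonunital_algebra.intro nonunital_ring.intro nonunital_ring_axioms.intro
      nonunital_algebra_axioms.intro KS_module KS_abelian_group)
     (simp_all add: KS_mult_closed KS_mult_assoc KS_mult_l_distr KS_mult_r_distr KS_smult_mult)

lemma KS_ring:
  assumes "\<one>\<^bsub>S\<^esub> \<in> carrier S"
    and "\<And>s. s \<in> carrier S \<Longrightarrow> \<one>\<^bsub>S\<^esub> \<otimes>\<^bsub>S\<^esub> s = s \<and> s \<otimes>\<^bsub>S\<^esub> \<one>\<^bsub>S\<^esub> = s"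
  shows "ring KS"
proof (rule ringI[OF KS_abelian_group])
  have "\<one>\<^bsub>KS\<^esub> \<otimes>\<^bsub>KS\<^esub> f = f \<and> f \<otimes>\<^bsub>KS\<^esub> \<one>\<^bsub>KS\<^esub> = f" if "f \<in> carrier KS" for f
    using that
    by (induction f rule: KS_induct)
       (use assms in \<open>simp_all add: KS_simps(4) basis_elem_closed KS_mult_zero KS_smult_mult
          basis_elem_mult KS_mult_l_distr KS_mult_r_distr\<close>)
  then show "Group.monoid KS"
    by (intro Group.monoidI)
       (use assms in \<open>auto simp: KS_mult_closed KS_mult_assoc KS_simps(4) basis_elem_closed\<close>)
qed (simp_all add: KS_mult_l_distr KS_mult_r_distr)

end

section \<open>Quotient algebras\<close>

locale nonunital_algebra_ideal = nonunital_algebra K A + two_sided_ideal I A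
  for K (structure) and A (structure) and I +
  assumes smult_ideal: "c \<in> carrier K \<Longrightarrow> x \<in> I \<Longrightarrow> c \<odot>\<^bsub>A\<^esub> x \<in> I"
begin

sublocale ideal: nonunital_ideal I A
  by (intro nonunital_ideal.intro nonunital_ring_axioms two_sided_ideal_axioms)

abbreviation Q where "Q \<equiv> quotient_algebra A I"

lemma Q_Quot:
  "carrier Q = carrier (A Quot I)" "mult Q = mult (A Quot I)" "add Q = add (A Quot I)"
  "zero Q = zero (A Quot I)" "one Q = one (A Quot I)"
  by (simp_all add: quotient_algebra_def FactRing_def ring.extend_def module.fields_def)

lemmas Q_simps = ideal.quotient_simps[folded Q_Quot]

lemma Q_smult:
  assumes c: "c \<in> carrier K" and x: "x \<in> carrier A"
  shows "c \<odot>\<^bsub>Q\<^esub> (I +>\<^bsub>A\<^esub> x) = I +>\<^bsub>A\<^esub> (c \<odot>\<^bsub>A\<^esub> x)"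
proof -
  have "I +>\<^bsub>A\<^esub> (c \<odot>\<^bsub>A\<^esub> y) = I +>\<^bsub>A\<^esub> (c \<odot>\<^bsub>A\<^esub> x)" if y: "y \<in> I +>\<^bsub>A\<^esub> x" for y
  proof -
    obtain h where h: "h \<in> I" "y = h \<oplus>\<^bsub>A\<^esub> x"
      using y by (auto simp: a_r_coset_def')
    then have hc: "h \<in> carrier A" "c \<odot>\<^bsub>A\<^esub> h \<in> I"
      using a_subset c smult_ideal by auto
    then have "c \<odot>\<^bsub>A\<^esub> y \<ominus>\<^bsub>A\<^esub> c \<odot>\<^bsub>A\<^esub> x = c \<odot>\<^bsub>A\<^esub> h"
      using c x h by (simp add: smult_r_distr M.minus_eq M.a_assoc M.r_neg)
    then show ?thesis
      using c x h hc by (simp add: ideal.coset_eq_iff)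
  qed
  moreover have "x \<in> I +>\<^bsub>A\<^esub> x" using x by (rule ideal.a_rcos_self)
  moreover have "c \<odot>\<^bsub>Q\<^esub> Z = (\<Union>x\<in>Z. I +>\<^bsub>A\<^esub> (c \<odot>\<^bsub>A\<^esub> x))" for Z
    by (simp add: quotient_algebra_def FactRing_def ring.extend_def module.fields_def)
  ultimately show ?thesis by blast
qed

lemma Q_nonunital_algebra: "nonunital_algebra K Q"
proof (intro nonunital_algebra.intro nonunital_ring.intro)
  interpret quot: nonunital_ring "A Quot I" by (rule ideal.quotient_nonunital_ring)
  show "abelian_group Q"
  proof (rule abelian_groupI, unfold Q_Quot)
    fix x assume "x \<in> carrier (A Quot I)"
    then show "\<exists>y\<in>carrier (A Quot I). y \<oplus>\<^bsub>A Quot I\<^esub> x = \<zero>\<^bsub>A Quot I\<^esub>"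
      using quot.l_neg by blast
  qed (simp_all add: quot.a_ac)
  then show "module K Q"
    by (rule moduleI[OF R.is_cring])
       (auto simp: Q_simps Q_smult smult_l_distr smult_r_distr smult_assoc1)
  show "nonunital_ring_axioms Q"
    by (intro nonunital_ring_axioms.intro)
       (auto simp: Q_simps mult_closed mult_assoc mult_l_distr mult_r_distr)
  show "nonunital_algebra_axioms K Q"
    by unfold_locales (auto simp: Q_simps Q_smult mult_closed smult_mult_left smult_mult_right)
qed

end

lemma (in module) generated_submodule:
  assumes "S \<subseteq> carrier M"
  shows "submodule (generated_submodule R M S) R M" and "S \<subseteq> generated_submodule R M S"
proof -
  have "carrier M \<in> {N. submodule N R M \<and> S \<subseteq> N}"
    using assms carrier_is_submodule by simp
  then have sub: "generated_submodule R M S \<subseteq> carrier M"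
    unfolding generated_submodule_def by (rule Inter_lower)
  have zero: "\<zero>\<^bsub>M\<^esub> \<in> N" if "submodule N R M" for N
    using subgroup.one_closed[OF submodule.axioms(1)[OF that]] by simp
  show "submodule (generated_submodule R M S) R M"
    by (rule submoduleI[OF sub]) (use zero in \<open>auto simp: generated_submodule_def dest: submoduleE\<close>)
  show "S \<subseteq> generated_submodule R M S"
    unfolding generated_submodule_def by blast
qed

text \<open>
  The elements of the generated submodule \<open>N\<close> whose products with everything stay in \<open>N\<close> form a
  submodule, so it is enough to test the generators.
\<close>

lemma (in nonunital_algebra) generated_submodule_ideal:
  assumes S: "S \<subseteq> carrier A"
    and left: "\<And>f x. f \<in> carrier A \<Longrightarrow> x \<in> S \<Longrightarrow> f \<otimes>\<^bsub>A\<^esub> x \<in> generated_submodule K A S"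
    and right: "\<And>f x. f \<in> carrier A \<Longrightarrow> x \<in> S \<Longrightarrow> x \<otimes>\<^bsub>A\<^esub> f \<in> generated_submodule K A S"
  shows "nonunital_algebra_ideal K A (generated_submodule K A S)"
proof -
  define N where "N = generated_submodule K A S"
  have N: "submodule N K A" and SN: "S \<subseteq> N"
    unfolding N_def by (rule generated_submodule[OF S])+
  note NE = submoduleE[OF N]
  have zero: "\<zero>\<^bsub>A\<^esub> \<in> N"
    using subgroup.one_closed[OF submodule.axioms(1)[OF N]] by simp
  let ?M = "{x \<in> N. \<forall>f\<in>carrier A. f \<otimes>\<^bsub>A\<^esub> x \<in> N \<and> x \<otimes>\<^bsub>A\<^esub> f \<in> N}"
  have "submodule ?M K A"
  proof (rule submoduleI)
    show "?M \<subseteq> carrier A" using NE(1) by blast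
    show "\<zero>\<^bsub>A\<^esub> \<in> ?M" using zero by simp
    fix x y assume "x \<in> ?M" "y \<in> ?M"
    moreover from this have "x \<in> carrier A" "y \<in> carrier A" using NE(1) by auto
    ultimately show "\<ominus>\<^bsub>A\<^esub> x \<in> ?M" "x \<oplus>\<^bsub>A\<^esub> y \<in> ?M"
      using NE(3,5) by (simp_all add: mult_minus minus_mult mult_l_distr mult_r_distr)
  next
    fix c x assume "c \<in> carrier K" "x \<in> ?M"
    moreover from this have "x \<in> carrier A" using NE(1) by auto
    ultimately show "c \<odot>\<^bsub>A\<^esub> x \<in> ?M"
      using NE(4) by (simp add: smult_mult_left smult_mult_right)
  qed
  moreover have "S \<subseteq> ?M"
    using SN left right unfolding N_def by blast
  ultimately have "N \<subseteq> ?M"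
    unfolding N_def generated_submodule_def by blast
  moreover have "subgroup N (add_monoid A)"
    by (rule submodule.axioms(1)[OF N])
  ultimately show ?thesis
    unfolding N_def[symmetric] using NE(4)
    by (intro nonunital_algebra_ideal.intro two_sided_ideal.intro additive_subgroup.intro
        two_sided_ideal_axioms.intro nonunital_algebra_ideal_axioms.intro nonunital_algebra_axioms)
       auto
qed

section \<open>Tensor products\<close>

locale tensor_product = A: nonunital_algebra K A + B: nonunital_algebra K B
  for K :: "('k, 'c) ring_scheme" and A :: "('k, 'a, 'm) module_scheme"
    and B :: "('k, 'b, 'n) module_scheme"
begin

sublocale pairs: semigroup_over_cring K "A \<times>\<times> B"
  by unfold_locales (auto simp: DirProd_def A.mult_closed B.mult_closed A.mult_assoc B.mult_assoc)

abbreviation F where "F \<equiv> semigroup_algebra K (A \<times>\<times> B)"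
abbreviation N where "N \<equiv> generated_submodule K F (tensor_relators K A B)"

sublocale F: nonunital_algebra K F
  by (rule pairs.KS_nonunital_algebra)

abbreviation b where "b x y \<equiv> basis_elem K (x, y)"

lemma b_closed [simp]: "x \<in> carrier A \<Longrightarrow> y \<in> carrier B \<Longrightarrow> b x y \<in> carrier F"
  by (simp add: pairs.basis_elem_closed)

lemma b_mult [simp]:
  assumes "x \<in> carrier A" "y \<in> carrier B" "x' \<in> carrier A" "y' \<in> carrier B"
  shows "b x y \<otimes>\<^bsub>F\<^esub> b x' y' = b (x \<otimes>\<^bsub>A\<^esub> x') (y \<otimes>\<^bsub>B\<^esub> y')"
proof -
  have "(x, y) \<otimes>\<^bsub>A \<times>\<times> B\<^esub> (x', y') = (x \<otimes>\<^bsub>A\<^esub> x', y \<otimes>\<^bsub>B\<^esub> y')"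
    by (simp add: DirProd_def)
  then show ?thesis
    using assms by (simp add: pairs.basis_elem_mult)
qed

lemma relators_iff:
  "f \<in> tensor_relators K A B \<longleftrightarrow>
    (\<exists>x x' y. f = b (x \<oplus>\<^bsub>A\<^esub> x') y \<ominus>\<^bsub>F\<^esub> (b x y \<oplus>\<^bsub>F\<^esub> b x' y) \<and>
      x \<in> carrier A \<and> x' \<in> carrier A \<and> y \<in> carrier B) \<or>
    (\<exists>x y y'. f = b x (y \<oplus>\<^bsub>B\<^esub> y') \<ominus>\<^bsub>F\<^esub> (b x y \<oplus>\<^bsub>F\<^esub> b x y') \<and>
      x \<in> carrier A \<and> y \<in> carrier B \<and> y' \<in> carrier B) \<or>
    (\<exists>c x y. f = b (c \<odot>\<^bsub>A\<^esub> x) y \<ominus>\<^bsub>F\<^esub> c \<odot>\<^bsub>F\<^esub> b x y \<and>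
      c \<in> carrier K \<and> x \<in> carrier A \<and> y \<in> carrier B) \<or>
    (\<exists>c x y. f = b x (c \<odot>\<^bsub>B\<^esub> y) \<ominus>\<^bsub>F\<^esub> c \<odot>\<^bsub>F\<^esub> b x y \<and>
      c \<in> carrier K \<and> x \<in> carrier A \<and> y \<in> carrier B)"
  by (simp add: tensor_relators_def Let_def)

lemma relator_add_left:
  assumes "x \<in> carrier A" "x' \<in> carrier A" "y \<in> carrier B"
  shows "b (x \<oplus>\<^bsub>A\<^esub> x') y \<ominus>\<^bsub>F\<^esub> (b x y \<oplus>\<^bsub>F\<^esub> b x' y) \<in> tensor_relators K A B"
  unfolding relators_iff by (rule disjI1, intro exI conjI, rule refl) (rule assms)+

lemma relator_add_right:
  assumes "x \<in> carrier A" "y \<in> carrier B" "y' \<in> carrier B"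
  shows "b x (y \<oplus>\<^bsub>B\<^esub> y') \<ominus>\<^bsub>F\<^esub> (b x y \<oplus>\<^bsub>F\<^esub> b x y') \<in> tensor_relators K A B"
  unfolding relators_iff by (rule disjI2, rule disjI1, intro exI conjI, rule refl) (rule assms)+

lemma relator_smult_left:
  assumes "c \<in> carrier K" "x \<in> carrier A" "y \<in> carrier B"
  shows "b (c \<odot>\<^bsub>A\<^esub> x) y \<ominus>\<^bsub>F\<^esub> c \<odot>\<^bsub>F\<^esub> b x y \<in> tensor_relators K A B"
  unfolding relators_iff by (rule disjI2, rule disjI2, rule disjI1, intro exI conjI, rule refl) (rule assms)+

lemma relator_smult_right:
  assumes "c \<in> carrier K" "x \<in> carrier A" "y \<in> carrier B"
  shows "b x (c \<odot>\<^bsub>B\<^esub> y) \<ominus>\<^bsub>F\<^esub> c \<odot>\<^bsub>F\<^esub> b x y \<in> tensor_relators K A B"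
  unfolding relators_iff by (rule disjI2, rule disjI2, rule disjI2, intro exI conjI, rule refl) (rule assms)+

lemmas relator_intros = relator_add_left relator_add_right relator_smult_left relator_smult_right

lemma relators_carrier: "tensor_relators K A B \<subseteq> carrier F"
  by (auto simp: relators_iff)

text \<open>
  The product with a basis element \<open>(p, q)\<close> turns a relator into the relator of the same kind for
  the products with \<open>p\<close> and \<open>q\<close>. This is why the submodule of relations is an ideal.
\<close>

lemma relators_mult:
  assumes f: "f \<in> tensor_relators K A B" and p: "p \<in> carrier A" "q \<in> carrier B"
  shows "b p q \<otimes>\<^bsub>F\<^esub> f \<in> tensor_relators K A B \<and> f \<otimes>\<^bsub>F\<^esub> b p q \<in> tensor_relators K A B"
proof -
  note simps = F.minus_eq F.mult_minus F.minus_mult F.mult_l_distr F.mult_r_distr F.mult_closed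
    F.smult_mult_left F.smult_mult_right
    A.mult_l_distr A.mult_r_distr A.smult_mult_left A.smult_mult_right A.mult_closed
    B.mult_l_distr B.mult_r_distr B.smult_mult_left B.smult_mult_right B.mult_closed
  from f show ?thesis
    unfolding relators_iff[of f]
  proof (elim disjE exE conjE)
    fix x x' y assume c: "x \<in> carrier A" "x' \<in> carrier A" "y \<in> carrier B"
      and f: "f = b (x \<oplus>\<^bsub>A\<^esub> x') y \<ominus>\<^bsub>F\<^esub> (b x y \<oplus>\<^bsub>F\<^esub> b x' y)"
    have eq: "b p q \<otimes>\<^bsub>F\<^esub> f = b (p \<otimes>\<^bsub>A\<^esub> x \<oplus>\<^bsub>A\<^esub> p \<otimes>\<^bsub>A\<^esub> x') (q \<otimes>\<^bsub>B\<^esub> y) \<ominus>\<^bsub>F\<^esub>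
        (b (p \<otimes>\<^bsub>A\<^esub> x) (q \<otimes>\<^bsub>B\<^esub> y) \<oplus>\<^bsub>F\<^esub> b (p \<otimes>\<^bsub>A\<^esub> x') (q \<otimes>\<^bsub>B\<^esub> y))"
      "f \<otimes>\<^bsub>F\<^esub> b p q = b (x \<otimes>\<^bsub>A\<^esub> p \<oplus>\<^bsub>A\<^esub> x' \<otimes>\<^bsub>A\<^esub> p) (y \<otimes>\<^bsub>B\<^esub> q) \<ominus>\<^bsub>F\<^esub>
        (b (x \<otimes>\<^bsub>A\<^esub> p) (y \<otimes>\<^bsub>B\<^esub> q) \<oplus>\<^bsub>F\<^esub> b (x' \<otimes>\<^bsub>A\<^esub> p) (y \<otimes>\<^bsub>B\<^esub> q))"
      using p c unfolding f by (simp_all add: simps)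
    show ?thesis
      unfolding eq by (intro conjI relator_intros p c A.mult_closed B.mult_closed)
  next
    fix x y y' assume c: "x \<in> carrier A" "y \<in> carrier B" "y' \<in> carrier B"
      and f: "f = b x (y \<oplus>\<^bsub>B\<^esub> y') \<ominus>\<^bsub>F\<^esub> (b x y \<oplus>\<^bsub>F\<^esub> b x y')"
    have eq: "b p q \<otimes>\<^bsub>F\<^esub> f = b (p \<otimes>\<^bsub>A\<^esub> x) (q \<otimes>\<^bsub>B\<^esub> y \<oplus>\<^bsub>B\<^esub> q \<otimes>\<^bsub>B\<^esub> y') \<ominus>\<^bsub>F\<^esub>
        (b (p \<otimes>\<^bsub>A\<^esub> x) (q \<otimes>\<^bsub>B\<^esub> y) \<oplus>\<^bsub>F\<^esub> b (p \<otimes>\<^bsub>A\<^esub> x) (q \<otimes>\<^bsub>B\<^esub> y'))"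
      "f \<otimes>\<^bsub>F\<^esub> b p q = b (x \<otimes>\<^bsub>A\<^esub> p) (y \<otimes>\<^bsub>B\<^esub> q \<oplus>\<^bsub>B\<^esub> y' \<otimes>\<^bsub>B\<^esub> q) \<ominus>\<^bsub>F\<^esub>
        (b (x \<otimes>\<^bsub>A\<^esub> p) (y \<otimes>\<^bsub>B\<^esub> q) \<oplus>\<^bsub>F\<^esub> b (x \<otimes>\<^bsub>A\<^esub> p) (y' \<otimes>\<^bsub>B\<^esub> q))"
      using p c unfolding f by (simp_all add: simps)
    show ?thesis
      unfolding eq by (intro conjI relator_intros p c A.mult_closed B.mult_closed)
  next
    fix c x y assume c: "c \<in> carrier K" "x \<in> carrier A" "y \<in> carrier B"
      and f: "f = b (c \<odot>\<^bsub>A\<^esub> x) y \<ominus>\<^bsub>F\<^esub> c \<odot>\<^bsub>F\<^esub> b x y"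
    have eq: "b p q \<otimes>\<^bsub>F\<^esub> f = b (c \<odot>\<^bsub>A\<^esub> (p \<otimes>\<^bsub>A\<^esub> x)) (q \<otimes>\<^bsub>B\<^esub> y) \<ominus>\<^bsub>F\<^esub>
        c \<odot>\<^bsub>F\<^esub> b (p \<otimes>\<^bsub>A\<^esub> x) (q \<otimes>\<^bsub>B\<^esub> y)"
      "f \<otimes>\<^bsub>F\<^esub> b p q = b (c \<odot>\<^bsub>A\<^esub> (x \<otimes>\<^bsub>A\<^esub> p)) (y \<otimes>\<^bsub>B\<^esub> q) \<ominus>\<^bsub>F\<^esub>
        c \<odot>\<^bsub>F\<^esub> b (x \<otimes>\<^bsub>A\<^esub> p) (y \<otimes>\<^bsub>B\<^esub> q)"
      using p c unfolding f by (simp_all add: simps)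
    show ?thesis
      unfolding eq by (intro conjI relator_intros p c A.mult_closed B.mult_closed)
  next
    fix c x y assume c: "c \<in> carrier K" "x \<in> carrier A" "y \<in> carrier B"
      and f: "f = b x (c \<odot>\<^bsub>B\<^esub> y) \<ominus>\<^bsub>F\<^esub> c \<odot>\<^bsub>F\<^esub> b x y"
    have eq: "b p q \<otimes>\<^bsub>F\<^esub> f = b (p \<otimes>\<^bsub>A\<^esub> x) (c \<odot>\<^bsub>B\<^esub> (q \<otimes>\<^bsub>B\<^esub> y)) \<ominus>\<^bsub>F\<^esub>
        c \<odot>\<^bsub>F\<^esub> b (p \<otimes>\<^bsub>A\<^esub> x) (q \<otimes>\<^bsub>B\<^esub> y)"
      "f \<otimes>\<^bsub>F\<^esub> b p q = b (x \<otimes>\<^bsub>A\<^esub> p) (c \<odot>\<^bsub>B\<^esub> (y \<otimes>\<^bsub>B\<^esub> q)) \<ominus>\<^bsub>F\<^esub>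
        c \<odot>\<^bsub>F\<^esub> b (x \<otimes>\<^bsub>A\<^esub> p) (y \<otimes>\<^bsub>B\<^esub> q)"
      using p c unfolding f by (simp_all add: simps)
    show ?thesis
      unfolding eq by (intro conjI relator_intros p c A.mult_closed B.mult_closed)
  qed
qed

sublocale N: nonunital_algebra_ideal K F N
proof (rule F.generated_submodule_ideal[OF relators_carrier])
  note N = F.generated_submodule[OF relators_carrier]
  note NE = F.submoduleE[OF N(1)]
  have N_zero: "\<zero>\<^bsub>F\<^esub> \<in> N"
    using subgroup.one_closed[OF submodule.axioms(1)[OF N(1)]] by simp
  fix f x assume "f \<in> carrier F" and x: "x \<in> tensor_relators K A B"
  then have xc: "x \<in> carrier F" using relators_carrier by blast
  from \<open>f \<in> carrier F\<close> have "f \<otimes>\<^bsub>F\<^esub> x \<in> N \<and> x \<otimes>\<^bsub>F\<^esub> f \<in> N"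
  proof (induction f rule: pairs.KS_induct)
    case zero
    then show ?case using N_zero xc by simp
  next
    case (smult_basis c s)
    obtain p q where s: "s = (p, q)" "p \<in> carrier A" "q \<in> carrier B"
      using smult_basis by (cases s) auto
    have "b p q \<otimes>\<^bsub>F\<^esub> x \<in> N" "x \<otimes>\<^bsub>F\<^esub> b p q \<in> N"
      using relators_mult[OF x s(2,3)] N(2) by auto
    then show ?case
      using smult_basis s xc NE(4) by (simp add: F.smult_mult_left F.smult_mult_right)
  next
    case (add f g)
    then show ?case
      using xc NE(5) by (simp add: F.mult_l_distr F.mult_r_distr)
  qed
  then show "f \<otimes>\<^bsub>F\<^esub> x \<in> N" "x \<otimes>\<^bsub>F\<^esub> f \<in> N" by auto
qed

abbreviation T where "T \<equiv> tensor_algebra K A B"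

lemma T_eq: "T = quotient_algebra F N"
  by (simp add: tensor_algebra_def Let_def)

sublocale T: nonunital_algebra K T
  unfolding T_eq by (rule N.Q_nonunital_algebra)

definition pure :: "'a \<Rightarrow> 'b \<Rightarrow> ('a \<times> 'b \<Rightarrow> 'k) set"
  where "pure x y = N +>\<^bsub>F\<^esub> b x y"

lemma pure_closed: "x \<in> carrier A \<Longrightarrow> y \<in> carrier B \<Longrightarrow> pure x y \<in> carrier T"
  by (simp add: T_eq N.Q_simps pure_def)

lemma pure_mult:
  assumes "x \<in> carrier A" "y \<in> carrier B" "x' \<in> carrier A" "y' \<in> carrier B"
  shows "pure x y \<otimes>\<^bsub>T\<^esub> pure x' y' = pure (x \<otimes>\<^bsub>A\<^esub> x') (y \<otimes>\<^bsub>B\<^esub> y')"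
  using assms by (simp add: T_eq N.Q_simps pure_def)

lemma relator_coset_eq:
  assumes "f \<ominus>\<^bsub>F\<^esub> g \<in> tensor_relators K A B" "f \<in> carrier F" "g \<in> carrier F"
  shows "N +>\<^bsub>F\<^esub> f = N +>\<^bsub>F\<^esub> g"
  using assms F.generated_submodule(2)[OF relators_carrier] N.ideal.coset_eq_iff by blast

lemma pure_add_left:
  assumes "x \<in> carrier A" "x' \<in> carrier A" "y \<in> carrier B"
  shows "pure (x \<oplus>\<^bsub>A\<^esub> x') y = pure x y \<oplus>\<^bsub>T\<^esub> pure x' y"
proof -
  have "N +>\<^bsub>F\<^esub> b (x \<oplus>\<^bsub>A\<^esub> x') y = N +>\<^bsub>F\<^esub> (b x y \<oplus>\<^bsub>F\<^esub> b x' y)"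
    by (rule relator_coset_eq) (use assms in \<open>simp_all add: relator_intros\<close>)
  then show ?thesis
    using assms by (simp add: T_eq N.Q_simps pure_def)
qed

lemma pure_add_right:
  assumes "x \<in> carrier A" "y \<in> carrier B" "y' \<in> carrier B"
  shows "pure x (y \<oplus>\<^bsub>B\<^esub> y') = pure x y \<oplus>\<^bsub>T\<^esub> pure x y'"
proof -
  have "N +>\<^bsub>F\<^esub> b x (y \<oplus>\<^bsub>B\<^esub> y') = N +>\<^bsub>F\<^esub> (b x y \<oplus>\<^bsub>F\<^esub> b x y')"
    by (rule relator_coset_eq) (use assms in \<open>simp_all add: relator_intros\<close>)
  then show ?thesis
    using assms by (simp add: T_eq N.Q_simps pure_def)
qed

lemma pure_smult:
  assumes "c \<in> carrier K" "x \<in> carrier A" "y \<in> carrier B"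
  shows "pure (c \<odot>\<^bsub>A\<^esub> x) y = c \<odot>\<^bsub>T\<^esub> pure x y" and "pure x (c \<odot>\<^bsub>B\<^esub> y) = c \<odot>\<^bsub>T\<^esub> pure x y"
proof -
  have "N +>\<^bsub>F\<^esub> b (c \<odot>\<^bsub>A\<^esub> x) y = N +>\<^bsub>F\<^esub> (c \<odot>\<^bsub>F\<^esub> b x y)"
    by (rule relator_coset_eq) (use assms in \<open>simp_all add: relator_intros\<close>)
  then show "pure (c \<odot>\<^bsub>A\<^esub> x) y = c \<odot>\<^bsub>T\<^esub> pure x y"
    using assms by (simp add: T_eq N.Q_smult pure_def)
  have "N +>\<^bsub>F\<^esub> b x (c \<odot>\<^bsub>B\<^esub> y) = N +>\<^bsub>F\<^esub> (c \<odot>\<^bsub>F\<^esub> b x y)"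
    by (rule relator_coset_eq) (use assms in \<open>simp_all add: relator_intros\<close>)
  then show "pure x (c \<odot>\<^bsub>B\<^esub> y) = c \<odot>\<^bsub>T\<^esub> pure x y"
    using assms by (simp add: T_eq N.Q_smult pure_def)
qed

lemma pure_zero:
  shows "y \<in> carrier B \<Longrightarrow> pure \<zero>\<^bsub>A\<^esub> y = \<zero>\<^bsub>T\<^esub>" and "x \<in> carrier A \<Longrightarrow> pure x \<zero>\<^bsub>B\<^esub> = \<zero>\<^bsub>T\<^esub>"
  using pure_smult(1)[of "\<zero>\<^bsub>K\<^esub>" "\<zero>\<^bsub>A\<^esub>" y] pure_smult(2)[of "\<zero>\<^bsub>K\<^esub>" x "\<zero>\<^bsub>B\<^esub>"]
    pure_closed[of "\<zero>\<^bsub>A\<^esub>" y] pure_closed[of x "\<zero>\<^bsub>B\<^esub>"]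
  by simp_all

lemma tensor_induct [consumes 1, case_names pure add]:
  assumes z: "z \<in> carrier T"
    and pure: "\<And>x y. x \<in> carrier A \<Longrightarrow> y \<in> carrier B \<Longrightarrow> P (pure x y)"
    and add: "\<And>z z'. z \<in> carrier T \<Longrightarrow> z' \<in> carrier T \<Longrightarrow> P z \<Longrightarrow> P z' \<Longrightarrow> P (z \<oplus>\<^bsub>T\<^esub> z')"
  shows "P z"
proof -
  obtain f where f: "f \<in> carrier F" "z = N +>\<^bsub>F\<^esub> f"
    using z by (auto simp: T_eq N.Q_simps)
  from f(1) have "P (N +>\<^bsub>F\<^esub> f)"
  proof (induction f rule: pairs.KS_induct)
    case zero
    have "N +>\<^bsub>F\<^esub> \<zero>\<^bsub>F\<^esub> = pure \<zero>\<^bsub>A\<^esub> \<zero>\<^bsub>B\<^esub>"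
      using pure_zero(1)[of "\<zero>\<^bsub>B\<^esub>"] by (simp add: T_eq N.Q_simps N.ideal.coset_zero)
    then show ?case using pure by simp
  next
    case (smult_basis c s)
    obtain x y where s: "s = (x, y)" "x \<in> carrier A" "y \<in> carrier B"
      using smult_basis by (cases s) auto
    then have "N +>\<^bsub>F\<^esub> (c \<odot>\<^bsub>F\<^esub> basis_elem K s) = pure (c \<odot>\<^bsub>A\<^esub> x) y"
      using smult_basis pure_smult(1)[of c x y] by (simp add: T_eq N.Q_smult pure_def)
    then show ?case using pure s smult_basis by simp
  next
    case (add f g)
    then show ?case
      using assms(3)[of "N +>\<^bsub>F\<^esub> f" "N +>\<^bsub>F\<^esub> g"] by (simp add: T_eq N.Q_simps)
  qed
  then show ?thesis by (simp add: f)
qed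

end

section \<open>The Leavitt algebra and its tensor products\<close>

locale leavitt = cring K for K :: "('k, 'c) ring_scheme" (structure)
begin

sublocale words: semigroup_over_cring K "word_monoid :: leavitt_gen list monoid"
  by unfold_locales (auto simp: word_monoid_def)

abbreviation FA :: "('k, leavitt_gen list \<Rightarrow> 'k) module" where "FA \<equiv> free_algebra K"
abbreviation I where "I \<equiv> Idl\<^bsub>FA\<^esub> (leavitt_relators K)"
abbreviation L where "L \<equiv> leavitt_algebra K"

lemma FA_eq: "FA = semigroup_algebra K word_monoid"
  by (simp add: free_algebra_def)

sublocale FA: nonunital_algebra K FA
  unfolding FA_eq by (rule words.KS_nonunital_algebra)

sublocale FA_ring: ring FA
  unfolding FA_eq by (rule words.KS_ring) (auto simp: word_monoid_def)

lemma word_closed [simp]: "basis_elem K w \<in> carrier FA"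
  unfolding FA_eq by (rule words.basis_elem_closed) (simp add: word_monoid_def)

lemma word_mult [simp]: "basis_elem K w \<otimes>\<^bsub>FA\<^esub> basis_elem K w' = basis_elem K (w @ w')"
  unfolding FA_eq by (subst words.basis_elem_mult) (simp_all add: word_monoid_def)

lemma FA_one: "\<one>\<^bsub>FA\<^esub> = basis_elem K []"
  by (simp add: free_algebra_def semigroup_algebra_def word_monoid_def)

lemma leavitt_relators_carrier: "leavitt_relators K \<subseteq> carrier FA"
  by (auto simp: leavitt_relators_def Let_def)

sublocale I: nonunital_algebra_ideal K FA I
proof -
  interpret ideal I FA
    by (rule FA_ring.genideal_ideal[OF leavitt_relators_carrier])
  have "c \<odot>\<^bsub>FA\<^esub> x \<in> I" if "c \<in> carrier K" "x \<in> I" for c x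
  proof -
    have "(c \<odot>\<^bsub>FA\<^esub> \<one>\<^bsub>FA\<^esub>) \<otimes>\<^bsub>FA\<^esub> x \<in> I"
      using that by (intro I_l_closed) auto
    then show ?thesis
      using that a_Hcarr[OF that(2)] by (simp add: FA.smult_mult_left)
  qed
  then show "nonunital_algebra_ideal K FA I"
    by unfold_locales (auto intro: I_l_closed I_r_closed)
qed

lemma L_eq: "L = quotient_algebra FA I"
  by (simp add: leavitt_algebra_def)

sublocale L: nonunital_algebra K L
  unfolding L_eq by (rule I.Q_nonunital_algebra)

definition word :: "leavitt_gen list \<Rightarrow> (leavitt_gen list \<Rightarrow> 'k) set"
  where "word w = I +>\<^bsub>FA\<^esub> basis_elem K w"

lemma word_class_closed: "word w \<in> carrier L"
  by (simp add: word_def L_eq I.Q_simps)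

lemma word_class_mult: "word w \<otimes>\<^bsub>L\<^esub> word w' = word (w @ w')"
  by (simp add: word_def L_eq I.Q_simps)

lemma word_XY: "word (w @ X i # Y j # w') = (if i = j then word (w @ w') else \<zero>\<^bsub>L\<^esub>)"
proof -
  let ?d = "if i = j then \<one>\<^bsub>FA\<^esub> else \<zero>\<^bsub>FA\<^esub>"
  have "basis_elem K [X i] \<otimes>\<^bsub>FA\<^esub> basis_elem K [Y j] \<ominus>\<^bsub>FA\<^esub> ?d \<in> I"
    using FA_ring.genideal_self[OF leavitt_relators_carrier]
    unfolding leavitt_relators_def Let_def by blast
  then have "I +>\<^bsub>FA\<^esub> basis_elem K [X i, Y j] = I +>\<^bsub>FA\<^esub> ?d"
    by (simp add: I.ideal.coset_eq_iff)
  then have XY: "word [X i, Y j] = (if i = j then word [] else \<zero>\<^bsub>L\<^esub>)"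
    by (simp add: word_def FA_one L_eq I.Q_simps I.ideal.coset_zero)
  have "word (w @ X i # Y j # w') = word w \<otimes>\<^bsub>L\<^esub> word [X i, Y j] \<otimes>\<^bsub>L\<^esub> word w'"
    by (simp add: word_class_mult)
  then show ?thesis
    by (simp add: XY word_class_mult word_class_closed)
qed

lemma leavitt_induct [consumes 1, case_names zero smult_word add]:
  assumes l: "l \<in> carrier L"
    and zero: "P \<zero>\<^bsub>L\<^esub>"
    and smult_word: "\<And>c w. c \<in> carrier K \<Longrightarrow> P (c \<odot>\<^bsub>L\<^esub> word w)"
    and add: "\<And>l l'. l \<in> carrier L \<Longrightarrow> l' \<in> carrier L \<Longrightarrow> P l \<Longrightarrow> P l' \<Longrightarrow> P (l \<oplus>\<^bsub>L\<^esub> l')"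
  shows "P l"
proof -
  obtain f where f: "f \<in> carrier FA" "l = I +>\<^bsub>FA\<^esub> f"
    using l by (auto simp: L_eq I.Q_simps)
  from f(1) have "P (I +>\<^bsub>FA\<^esub> f)"
    unfolding FA_eq
  proof (induction f rule: words.KS_induct)
    case zero
    then show ?case
      using \<open>P \<zero>\<^bsub>L\<^esub>\<close> by (simp add: L_eq I.Q_simps I.ideal.coset_zero flip: FA_eq)
  next
    case (smult_basis c w)
    then show ?case
      using smult_word[of c w] by (simp add: L_eq I.Q_smult word_def flip: FA_eq)
  next
    case (add f g)
    then show ?case
      using assms(4)[of "I +>\<^bsub>FA\<^esub> f" "I +>\<^bsub>FA\<^esub> g"] by (simp add: L_eq I.Q_simps flip: FA_eq)
  qed
  then show ?thesis by (simp add: f)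
qed

end

text \<open>
  Scalars are moved into the first factor, \<open>a \<otimes> c w = c a \<otimes> w\<close>, so that sums of pure tensors
  \<open>a \<otimes> w\<close> with words \<open>w\<close> exhaust the tensor product without scalar coefficients.
\<close>

lemma tensor_leavitt_span:
  assumes "nonunital_algebra K A" "s_unital_ring A"
  shows "leavitt_span A (tensor_algebra K A (leavitt_algebra K))
    (\<lambda>a w. tensor_product.pure K A (leavitt_algebra K) a (leavitt.word K w))"
proof -
  interpret A: nonunital_algebra K A by fact
  interpret leavitt K ..
  interpret tensor_product K A L ..
  show ?thesis
  proof (intro leavitt_span.intro leavitt_span_axioms.intro assms(2) T.nonunital_ring_axioms)
    fix z P assume z: "z \<in> carrier T"
      and gen: "\<And>a w. a \<in> carrier A \<Longrightarrow> P (pure a (word w))"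
      and sum: "\<And>x y. x \<in> carrier T \<Longrightarrow> y \<in> carrier T \<Longrightarrow> P x \<Longrightarrow> P y \<Longrightarrow> P (x \<oplus>\<^bsub>T\<^esub> y)"
    from z show "P z"
    proof (induction z rule: tensor_induct)
      case (pure a l)
      from pure(2,1) show ?case
      proof (induction l rule: leavitt_induct)
        case zero
        have "pure a \<zero>\<^bsub>L\<^esub> = pure \<zero>\<^bsub>A\<^esub> (word [])"
          using zero by (simp add: pure_zero word_class_closed)
        then show ?case using gen by simp
      next
        case (smult_word c w)
        then have "pure a (c \<odot>\<^bsub>L\<^esub> word w) = pure (c \<odot>\<^bsub>A\<^esub> a) (word w)"
          by (simp add: pure_smult word_class_closed)
        then show ?case using gen smult_word by simp
      next
        case (add l l')
        then show ?case
          by (simp add: pure_add_right pure_closed sum)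
      qed
    qed (rule sum)
  qed (simp_all add: pure_closed pure_add_left pure_mult word_class_mult word_class_closed word_XY
        pure_zero)
qed

theorem theorem4p6:
  fixes K :: "('k, 'c) ring_scheme" and A :: "('k, 'a, 'm) module_scheme"
  assumes "field K"
    and "nonunital_algebra K A"
    and "s_unital_ring A"
    and "\<And>I J. two_sided_ideal I A \<Longrightarrow> right_ideal J (A Quot I) \<Longrightarrow> J \<noteq> {\<zero>\<^bsub>A Quot I\<^esub>} \<Longrightarrow>
      \<exists>e\<in>J. e \<noteq> \<zero>\<^bsub>A Quot I\<^esub> \<and> is_idempotent (A Quot I) e"
  shows "properly_purely_infinite_ring (tensor_algebra K A (leavitt_algebra K))"
  using assms(4) tensor_leavitt_span[OF assms(2,3)]
  by (intro leavitt_span_idempotents.properly_purely_infinite leavitt_span_idempotents.intro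
      leavitt_span_idempotents_axioms.intro)

end
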